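(* Let $k \geq 1$, let $\boldsymbol{\alpha} = (\alpha_1,\dots,\alpha_k) \in (0,1]^k$ with $\sum_{i=1}^k \alpha_i = 1$, and let $P = (p_{ij})_{i,j \in [k]}$ be a symmetric matrix with all $p_{ij} \in (0,1)$. Let $G \sim G(n,\boldsymbol{\alpha},P)$ be a random block graph. Then with high probability (i.e. with probability tending to $1$ as $n \to \infty$) \[ \chi(G) = (1+o(1)) \frac{n}{c^\star \ln n}, \] where \[ c^\star = c^\star(\boldsymbol{\alpha},P) = \max\big\{ |\mathbf{c}| : \mathbf{c} \in \mathrm{conv}(\mathcal{A}) \cap \{ t\cdot \boldsymbol{\alpha} : t \in \mathbb{R}_{\geq 0}\}\big\}. \]
   Context: $[k]=\{1,\dots,k\}$ and $p_i := p_{ii}$. The random block graph $G(n,\boldsymbol{\alpha},P)$ has vertex set $V = V_1 \cup \dots \cup V_k$, a disjoint union with $|V_i| = \alpha_i n$ (rounding ignored), $|V| = n$; for $i,j\in[k]$, two distinct vertices $u \in V_i$, $v \in V_j$ are joined by an edge with probability $p_{ij}$, independently for all pairs. Here $k$, $\boldsymbol{\alpha}$, $P$ are fixed and $n \to \infty$. $\chi(G)$ is the chromatic number. For $\mathbf{c} = (c_1,\dots,c_k)\in \mathbb{R}^k$, $|\mathbf{c}| = \sum_i |c_i|$ is the 1-norm. For $\mathbf{c}\in\mathbb{R}^k$ and $I \subseteq [k]$ define \[ g(\mathbf{c}, I) = \sum_{i\in I} c_i + \frac12 \sum_{i,j \in I} c_i c_j \ln(1-p_{ij}), \] and $\mathcal{A}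 = \{\mathbf{c} \in \mathbb{R}_{\geq 0}^k : g(\mathbf{c},I) \geq 0 \text{ for all } \varnothing \neq I \subseteq [k]\}$. $\mathrm{conv}(\mathcal{A})$ denotes the convex hull of $\mathcal{A}$. *)

theory Defs
  imports "HOL-Analysis.Analysis" "HOL-Probability.Probability"
begin

text \<open>A graph is given by a vertex set and a set of two-element subsets of it.\<close>

definition proper_coloring :: "'v set \<Rightarrow> 'v set set \<Rightarrow> nat \<Rightarrow> ('v \<Rightarrow> nat) \<Rightarrow> bool" where
  "proper_coloring V E q f \<longleftrightarrow>
     f ` V \<subseteq> {..<q} \<and> (\<forall>u\<in>V. \<forall>v\<in>V. u \<noteq> v \<and> {u, v} \<in> E \<longrightarrow> f u \<noteq> f v)"

definition chromatic_number :: "'v set \<Rightarrow> 'v set set \<Rightarrow> nat" where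
  "chromatic_number V E = (LEAST q. \<exists>f. proper_coloring V E q f)"

text \<open>
  The finite type \<open>'k\<close> plays the role of \<open>[k]\<close>. A partition of the vertex set \<open>{..<n}\<close>
  into blocks is given by the map \<open>b\<close> sending a vertex to the index of its block. Each block has
  size \<open>\<lfloor>\<alpha>\<^sub>i n\<rfloor>\<close> or \<open>\<lceil>\<alpha>\<^sub>i n\<rceil>\<close>; this fixes the
  meaning of \<open>|V\<^sub>i| = \<alpha>\<^sub>i n\<close> up to rounding.
\<close>

definition block_partition :: "real ^ 'k \<Rightarrow> nat \<Rightarrow> (nat \<Rightarrow> 'k) \<Rightarrow> bool" where
  "block_partition \<alpha> n b \<longleftrightarrow>
     (\<forall>i. \<bar>real (card {v \<in> {..<n}. b v = i}) - \<alpha> $ i * real n\<bar> < 1)"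

text \<open>
  Unordered pairs of distinct vertices are represented by pairs \<open>(u, v)\<close> with \<open>u < v\<close>;
  the map \<open>present\<close> says which of them are edges.
\<close>

definition random_block_graph :: "nat \<Rightarrow> (nat \<Rightarrow> 'k) \<Rightarrow> real ^ 'k ^ 'k \<Rightarrow> nat set set pmf" where
  "random_block_graph n b P =
     map_pmf (\<lambda>present. {{u, v} | u v. u < v \<and> v < n \<and> present (u, v)})
       (Pi_pmf {(u, v). u < v \<and> v < n} False (\<lambda>(u, v). bernoulli_pmf (P $ b u $ b v)))"

definition one_norm :: "real ^ 'k \<Rightarrow> real" where
  "one_norm c = (\<Sum>i\<in>UNIV. \<bar>c $ i\<bar>)"

definition g :: "real ^ 'k ^ 'k \<Rightarrow> real ^ 'k \<Rightarrow> 'k set \<Rightarrow> real" where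
  "g P c I = (\<Sum>i\<in>I. c $ i) + 1 / 2 * (\<Sum>i\<in>I. \<Sum>j\<in>I. c $ i * c $ j * ln (1 - P $ i $ j))"

definition admissible :: "real ^ 'k ^ 'k \<Rightarrow> (real ^ 'k) set" where
  "admissible P = {c. (\<forall>i. 0 \<le> c $ i) \<and> (\<forall>I. I \<noteq> {} \<longrightarrow> 0 \<le> g P c I)}"

definition cstar_values :: "real ^ 'k \<Rightarrow> real ^ 'k ^ 'k \<Rightarrow> real set" where
  "cstar_values \<alpha> P = one_norm ` (convex hull (admissible P) \<inter> {t *\<^sub>R \<alpha> | t. 0 \<le> t})"

definition cstar :: "real ^ 'k \<Rightarrow> real ^ 'k ^ 'k \<Rightarrow> real" where
  "cstar \<alpha> P = (GREATEST x. x \<in> cstar_values \<alpha> P)"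

lemma compact_admissible:
  fixes P :: "real ^ 'k ^ 'k"
  assumes P: "\<And>i j. 0 < P $ i $ j \<and> P $ i $ j < 1"
  shows "compact (admissible P)"
proof -
  have "closed (admissible P)"
    unfolding admissible_def g_def
    by (intro closed_Collect_conj closed_Collect_all closed_Collect_imp open_Collect_const
        closed_Collect_le continuous_intros)
  moreover have "bounded (admissible P)"
  proof -
    define B where "B = (\<Sum>i\<in>UNIV. 2 / (- ln (1 - P $ i $ i)))"
    have "c $ i \<in> {0..B}" if c: "c \<in> admissible P" for c i
    proof -
      define L where "L j = - ln (1 - P $ j $ j)" for j
      have L: "L j > 0" for j using P[of j j] by (simp add: L_def)
      have c0: "c $ i \<ge> 0" and "g P c {i} \<ge> 0"
        using c by (auto simp: admissible_def)
      then have *: "c $ i * (2 - c $ i * L i) \<ge> 0"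
        by (simp add: g_def L_def algebra_simps)
      have "c $ i \<le> 2 / L i"
      proof (cases "c $ i = 0")
        case True
        then show ?thesis using L[of i] by simp
      next
        case False
        then have "2 - c $ i * L i \<ge> 0"
          using * c0 by (simp add: zero_le_mult_iff)
        then show ?thesis using L[of i] by (simp add: field_simps)
      qed
      also have "\<dots> \<le> (\<Sum>j\<in>UNIV. 2 / L j)"
        by (rule member_le_sum) (auto simp: less_imp_le[OF L])
      finally show ?thesis using c0 by (simp add: B_def L_def)
    qed
    then have "admissible P \<subseteq> cbox 0 (\<chi> i. B)"
      by (auto simp: mem_box_cart)
    then show ?thesis using bounded_cbox bounded_subset by blast
  qed
  ultimately show ?thesis by (simp add: compact_eq_bounded_closed)
qed

lemma cstar_is_max:
  fixes \<alpha> :: "real ^ 'k" and P :: "real ^ 'k ^ 'k"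
  assumes P: "\<And>i j. 0 < P $ i $ j \<and> P $ i $ j < 1"
  shows "cstar \<alpha> P \<in> cstar_values \<alpha> P"
    and "x \<in> cstar_values \<alpha> P \<Longrightarrow> x \<le> cstar \<alpha> P"
proof -
  let ?ray = "{t *\<^sub>R \<alpha> | t. 0 \<le> t}"
  have "closed ?ray"
  proof (cases "\<alpha> = 0")
    case True
    then have "?ray = {0}" by auto
    then show ?thesis by simp
  next
    case False
    then have "0 < \<alpha> \<bullet> \<alpha>" by simp
    then have "?ray = span {\<alpha>} \<inter> {x. 0 \<le> \<alpha> \<bullet> x}"
      by (auto simp: span_singleton zero_le_mult_iff simp del: inner_gt_zero_iff)
    then show ?thesis
      by (simp add: closed_Int closed_halfspace_ge closed_Collect_le continuous_intros)
  qed
  then have "compact (convex hull (admissible P) \<inter> ?ray)"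
    by (intro compact_Int_closed compact_convex_hull compact_admissible P)
  then have "compact (cstar_values \<alpha> P)"
    unfolding cstar_values_def one_norm_def
    by (intro compact_continuous_image continuous_intros)
  moreover have "cstar_values \<alpha> P \<noteq> {}"
  proof -
    have "0 \<in> convex hull (admissible P)"
      by (rule hull_inc) (simp add: admissible_def g_def)
    moreover have "0 \<in> ?ray" by (auto intro: exI[of _ 0])
    ultimately show ?thesis unfolding cstar_values_def by blast
  qed
  ultimately obtain m where m: "m \<in> cstar_values \<alpha> P" "\<forall>y\<in>cstar_values \<alpha> P. y \<le> m"
    using compact_attains_sup by blast
  then have "cstar \<alpha> P = m"
    unfolding cstar_def by (intro Greatest_equality) auto
  with m show "cstar \<alpha> P \<in> cstar_values \<alpha> P"
    and "x \<in> cstar_values \<alpha> P \<Longrightarrow> x \<le> cstar \<alpha> P" by auto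
qed

end

theory Submission
  imports Defs "HOL-Real_Asymp.Real_Asymp"
begin

text \<open>
  Lower bound: a set \<open>S\<close> of vertices with block profile \<open>c ln n\<close> is independent with probability
  about \<open>exp ((ln n)\<^sup>2 (g c UNIV - |c|))\<close>, and there are at most \<open>n ^ |S|\<close> sets of that size. Applying
  the first moment method to all sets, hence to all sub-profiles of a set, shows that with high
  probability every independent set has a profile in \<open>(1 + o(1)) ln n\<close> times the admissible set. A
  colouring writes the profile of the vertex set, which is about \<open>n \<alpha>\<close>, as a sum of profiles of its
  colour classes; dividing by the number of colours and using that the admissible set is
  closed downwards gives a point of the convex hull on the ray through \<open>\<alpha>\<close>.

  Upper bound: by Janson's inequality, a vertex set with about \<open>n / (ln n)\<^sup>2\<close> vertices in each block
  contains no independent set of profile \<open>(1 - \<epsilon>) a ln n\<close>, where \<open>a\<close> is admissible, with probability at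
  most \<open>exp (- n powr (3 / 2) / 6)\<close>, which survives a union bound over all vertex sets. So one can
  greedily extract colour classes whose profiles follow a convex combination of admissible points equal
  to \<open>c\<^sup>\<star> \<alpha>\<close>, until few vertices are left; these are treated in the same way with classes inside
  single blocks, and the last \<open>o(n / ln n)\<close> vertices get private colours.
\<close>

section \<open>Product weights on subsets and Janson's inequality\<close>

lemma sum_Pow_insert:
  fixes f :: "'a set \<Rightarrow> 'b::comm_monoid_add"
  assumes "finite A" "x \<notin> A"
  shows "sum f (Pow (insert x A)) = (\<Sum>S\<in>Pow A. f (insert x S)) + (\<Sum>S\<in>Pow A. f S)"
proof -
  have "sum f (Pow (insert x A)) = sum f (Pow A) + sum f (insert x ` Pow A)"
    unfolding Pow_insert using assms by (intro sum.union_disjoint) auto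
  also have "sum f (insert x ` Pow A) = (\<Sum>S\<in>Pow A. f (insert x S))"
  proof (subst sum.reindex)
    show "inj_on (insert x) (Pow A)"
      using assms by (intro inj_onI) (metis Diff_insert_absorb PowD insert_absorb insert_ident subsetD)
  qed simp
  finally show ?thesis by (simp add: add.commute)
qed

lemma sum_Pow_power_card:
  fixes x :: "'b::comm_ring_1"
  assumes "finite A"
  shows "(\<Sum>S\<in>Pow A. x ^ card S) = (1 + x) ^ card A"
  using assms
proof (induction A)
  case (insert a A)
  have "card (insert a S) = Suc (card S)" if "S \<in> Pow A" for S
    using that insert.hyps by (subst card_insert_disjoint) (auto dest: finite_subset)
  then show ?case
    using insert by (simp add: sum_Pow_insert sum_distrib_left[symmetric] algebra_simps)
qed simp

text \<open>The unnormalised weights are needed because conditioning on the absence of a set of edges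
  amounts to putting \<open>a = 0\<close> on that set.\<close>

definition subset_sum :: "'e set \<Rightarrow> ('e \<Rightarrow> real) \<Rightarrow> ('e \<Rightarrow> real) \<Rightarrow> ('e set \<Rightarrow> real) \<Rightarrow> real" where
  "subset_sum E a b f = (\<Sum>S\<in>Pow E. (\<Prod>e\<in>S. a e) * (\<Prod>e\<in>E - S. b e) * f S)"

lemma subset_sum_empty [simp]: "subset_sum {} a b f = f {}"
  by (simp add: subset_sum_def)

lemma subset_sum_insert:
  assumes "finite E" "x \<notin> E"
  shows "subset_sum (insert x E) a b f =
    a x * subset_sum E a b (\<lambda>S. f (insert x S)) + b x * subset_sum E a b f"
proof -
  have 1: "(\<Prod>e\<in>insert x S. a e) * (\<Prod>e\<in>insert x E - insert x S. b e) * f (insert x S)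
     = a x * ((\<Prod>e\<in>S. a e) * (\<Prod>e\<in>E - S. b e) * f (insert x S))" if "S \<in> Pow E" for S
  proof -
    have "insert x E - insert x S = E - S" "x \<notin> S" "finite S"
      using that assms by (auto dest: finite_subset)
    then show ?thesis by simp
  qed
  have 2: "(\<Prod>e\<in>S. a e) * (\<Prod>e\<in>insert x E - S. b e) * f S
     = b x * ((\<Prod>e\<in>S. a e) * (\<Prod>e\<in>E - S. b e) * f S)" if "S \<in> Pow E" for S
  proof -
    have "insert x E - S = insert x (E - S)" using that assms by auto
    then show ?thesis using assms by simp
  qed
  show ?thesis
    unfolding subset_sum_def sum_Pow_insert[OF assms] sum_distrib_left
    by (intro arg_cong2[where f = "(+)"] sum.cong refl 1 2)
qed

lemma subset_sum_add: "subset_sum E a b (\<lambda>S. f S + h S) = subset_sum E a b f + subset_sum E a b h"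
  by (simp add: subset_sum_def algebra_simps sum.distrib)

lemma subset_sum_cmult: "subset_sum E a b (\<lambda>S. c * f S) = c * subset_sum E a b f"
  by (simp add: subset_sum_def sum_distrib_left mult_ac)

lemma subset_sum_sum: "subset_sum E a b (\<lambda>S. \<Sum>i\<in>I. f i S) = (\<Sum>i\<in>I. subset_sum E a b (f i))"
  unfolding subset_sum_def sum_distrib_left by (subst sum.swap) simp

lemma subset_sum_mono:
  assumes "\<And>e. e \<in> E \<Longrightarrow> 0 \<le> a e" "\<And>e. e \<in> E \<Longrightarrow> 0 \<le> b e" "\<And>S. S \<subseteq> E \<Longrightarrow> f S \<le> h S"
  shows "subset_sum E a b f \<le> subset_sum E a b h"
  unfolding subset_sum_def
  by (intro sum_mono mult_left_mono mult_nonneg_nonneg prod_nonneg) (use assms in auto)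

lemma subset_sum_nonneg:
  assumes "\<And>e. e \<in> E \<Longrightarrow> 0 \<le> a e" "\<And>e. e \<in> E \<Longrightarrow> 0 \<le> b e" "\<And>S. S \<subseteq> E \<Longrightarrow> 0 \<le> f S"
  shows "0 \<le> subset_sum E a b f"
  unfolding subset_sum_def
  by (intro sum_nonneg mult_nonneg_nonneg prod_nonneg) (use assms in auto)

lemma subset_sum_cong:
  assumes "\<And>S. S \<subseteq> E \<Longrightarrow> f S = h S"
  shows "subset_sum E a b f = subset_sum E a b h"
  unfolding subset_sum_def by (intro sum.cong) (use assms in auto)

lemma subset_sum_const:
  assumes "finite E"
  shows "subset_sum E a b (\<lambda>_. c) = c * (\<Prod>e\<in>E. a e + b e)"
  using assms by (induction E) (simp_all add: subset_sum_insert algebra_simps)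

text \<open>Induction on the ground set, splitting on whether \<open>e\<close> is present. After the
  induction hypothesis is used on both halves, the two sides differ by at least
  \<open>a e * b e * ((x1 - x0) * (y1 - y0))\<close>, which is nonnegative since both functions are
  increasing. The factor \<open>subset_sum E a b (\<lambda>_. 1)\<close> is the total mass; it keeps
  the inequality valid without normalisation.\<close>

lemma harris_subset_sum:
  assumes "finite E" "\<And>e. e \<in> E \<Longrightarrow> 0 \<le> a e" "\<And>e. e \<in> E \<Longrightarrow> 0 \<le> b e"
    and "mono f" "mono h"
  shows "subset_sum E a b f * subset_sum E a b h
    \<le> subset_sum E a b (\<lambda>S. f S * h S) * subset_sum E a b (\<lambda>_. 1)"
  using assms
proof (induction E arbitrary: f h)
  case (insert e E)
  let ?M = "subset_sum E a b"
  define x1 y1 x0 y0 Z p1 p0 where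
    "x1 = ?M (\<lambda>S. f (insert e S))" and "y1 = ?M (\<lambda>S. h (insert e S))"
    and "x0 = ?M f" and "y0 = ?M h" and "Z = ?M (\<lambda>_. 1)"
    and "p1 = ?M (\<lambda>S. f (insert e S) * h (insert e S))" and "p0 = ?M (\<lambda>S. f S * h S)"
  have m: "mono (\<lambda>S. f (insert e S))" "mono (\<lambda>S. h (insert e S))"
    using insert.prems(3,4) by (auto intro!: monoI intro: monoD[of f] monoD[of h] insert_mono)
  have q1: "x1 * y1 \<le> p1 * Z" and q0: "x0 * y0 \<le> p0 * Z"
    unfolding x1_def y1_def x0_def y0_def p1_def p0_def Z_def
    using insert.prems m by (auto intro!: insert.IH)
  have ab: "0 \<le> a e" "0 \<le> b e" using insert.prems by auto
  have "x0 \<le> x1" "y0 \<le> y1"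
    unfolding x1_def y1_def x0_def y0_def
    using insert.prems by (auto intro!: subset_sum_mono monoD[of f] monoD[of h])
  then have "0 \<le> a e * b e * ((x1 - x0) * (y1 - y0))" using ab by simp
  moreover have "a e * (a e + b e) * (x1 * y1) \<le> a e * (a e + b e) * (p1 * Z)"
    "b e * (a e + b e) * (x0 * y0) \<le> b e * (a e + b e) * (p0 * Z)"
    using ab q1 q0 by (auto intro!: mult_left_mono)
  ultimately have "(a e * x1 + b e * x0) * (a e * y1 + b e * y0) \<le>
    (a e * p1 + b e * p0) * (a e * Z + b e * Z)"
    by (simp add: algebra_simps)
  then show ?case
    using insert.hyps by (simp add: subset_sum_insert x1_def y1_def x0_def y0_def p1_def p0_def Z_def)
qed simp

text \<open>Independence: \<open>h\<close> ignores the elements of \<open>A\<close>, so these factor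
  out of the sum. Each of them contributes \<open>b e\<close> under the modified weights and
  \<open>a e + b e = 1\<close> under the original ones.\<close>

lemma subset_sum_absent_indep:
  assumes "finite E" "\<And>e. e \<in> E \<Longrightarrow> a e + b e = 1" "\<And>S. h S = h (S - A)"
  shows "subset_sum E (\<lambda>e. if e \<in> A then 0 else a e) b h = (\<Prod>e\<in>E \<inter> A. b e) * subset_sum E a b h"
  using assms
proof (induction E arbitrary: h)
  case (insert e E)
  have hA: "h S = h T" if "S - A = T - A" for S T
    using that insert.prems(2) by metis
  have ab: "a e + b e = 1" using insert.prems(1) by simp
  have IH: "subset_sum E (\<lambda>e. if e \<in> A then 0 else a e) b h' = (\<Prod>e\<in>E \<inter> A. b e) * subset_sum E a b h'"
    if "\<And>S. h' S = h' (S - A)" for h'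
    by (rule insert.IH) (use insert.prems(1) that in auto)
  have IH0: "subset_sum E (\<lambda>e. if e \<in> A then 0 else a e) b h = (\<Prod>e\<in>E \<inter> A. b e) * subset_sum E a b h"
    by (rule IH) (rule insert.prems(2))
  note ins = subset_sum_insert[OF insert.hyps]
  show ?case
  proof (cases "e \<in> A")
    case True
    have "h (insert e S) = h S" for S by (rule hA) (use True in auto)
    moreover have "a e * M + b e * M = M" for M :: real
      using ab by (simp add: distrib_right[symmetric])
    moreover have "insert e E \<inter> A = insert e (E \<inter> A)" using True by auto
    ultimately show ?thesis
      using insert.hyps True by (simp add: ins IH0)
  next
    case False
    have "h (insert e S) = h (insert e (S - A))" for S by (rule hA) auto
    note IH1 = IH[of "\<lambda>S. h (insert e S)", OF this]
    moreover have "insert e E \<inter> A = E \<inter> A" using False by auto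
    ultimately show ?thesis
      using False by (simp add: ins IH0 algebra_simps)
  qed
qed simp

text \<open>A set meeting \<open>A\<close> receives a zero factor. The indicator of avoiding
  \<open>A\<close> thus becomes a change of product weights, and Harris' inequality applies to the
  conditioned sum.\<close>

lemma subset_sum_absent:
  assumes "finite E" "A \<subseteq> E"
  shows "subset_sum E (\<lambda>e. if e \<in> A then 0 else a e) b h =
    subset_sum E a b (\<lambda>S. of_bool (S \<inter> A = {}) * h S)"
proof -
  have "(\<Prod>e\<in>S. if e \<in> A then 0 else a e) = (\<Prod>e\<in>S. a e) * of_bool (S \<inter> A = {})" if "S \<subseteq> E" for S
  proof (cases "S \<inter> A = {}")
    case True
    then have "(\<Prod>e\<in>S. if e \<in> A then 0 else a e) = (\<Prod>e\<in>S. a e)"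
      by (intro prod.cong) auto
    then show ?thesis using True by simp
  next
    case False
    then obtain x where "x \<in> S" "x \<in> A" by auto
    moreover have "finite S" using that assms(1) finite_subset by blast
    ultimately have "(\<Prod>e\<in>S. if e \<in> A then 0 else a e) = 0" by (intro prod_zero) auto
    then show ?thesis using False by simp
  qed
  then show ?thesis
    unfolding subset_sum_def by (intro sum.cong) (auto simp: mult_ac)
qed

lemma subset_sum_prob_absent:
  assumes "finite E" "A \<subseteq> E" "\<And>e. e \<in> E \<Longrightarrow> a e + b e = 1"
  shows "subset_sum E a b (\<lambda>S. of_bool (S \<inter> A = {})) = (\<Prod>e\<in>A. b e)"
proof -
  have "subset_sum E a b (\<lambda>S. of_bool (S \<inter> A = {}) * 1) = (\<Prod>e\<in>E \<inter> A. b e) * subset_sum E a b (\<lambda>_. 1)"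
    by (subst subset_sum_absent[symmetric], (rule assms)+) (rule subset_sum_absent_indep, use assms in auto)
  moreover have "E \<inter> A = A" using assms by auto
  ultimately show ?thesis using assms by (simp add: subset_sum_const)
qed


text \<open>Harris' inequality, applied to the weights conditioned on the absence of \<open>A i\<close>,
  decouples the sets that meet \<open>A i\<close> from those that do not; bounding \<open>e\<^sup>-\<^sup>x\<close> from below by
  \<open>1 - x\<close> then gives a differential inequality for the Laplace transform of the number of absent sets.\<close>

lemma janson_subset_sum:
  fixes A :: "'i \<Rightarrow> 'e set"
  assumes E: "finite E" and I: "finite I" and A: "\<And>i. i \<in> I \<Longrightarrow> A i \<subseteq> E"
    and ab: "\<And>e. e \<in> E \<Longrightarrow> a e + b e = 1" "\<And>e. e \<in> E \<Longrightarrow> 0 \<le> a e" "\<And>e. e \<in> E \<Longrightarrow> 0 < b e"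
    and mu: "\<mu> = (\<Sum>i\<in>I. \<Prod>e\<in>A i. b e)"
    and D: "(\<Sum>i\<in>I. \<Sum>j\<in>{j\<in>I. A i \<inter> A j \<noteq> {}}. \<Prod>e\<in>A i \<union> A j. b e) \<le> D" "0 < D"
  shows "subset_sum E a b (\<lambda>S. of_bool (\<forall>i\<in>I. S \<inter> A i \<noteq> {})) \<le> exp (- (\<mu>\<^sup>2 / (2 * D)))"
proof -
  let ?M = "subset_sum E a b"
  define Z where "Z i S = (of_bool (S \<inter> A i = {}) :: real)" for i S
  define X where "X S = (\<Sum>i\<in>I. Z i S)" for S
  define \<phi> where "\<phi> t = ?M (\<lambda>S. exp (- (t * X S)))" for t
  have b0: "0 \<le> b e" if "e \<in> E" for e using ab(3)[OF that] by simp
  have anti: "mono (\<lambda>S. exp (- (t * (\<Sum>j\<in>J. Z j S))))" if "0 \<le> t" for t J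
  proof (rule monoI)
    fix S T :: "'e set" assume "S \<subseteq> T"
    then have "(\<Sum>j\<in>J. Z j T) \<le> (\<Sum>j\<in>J. Z j S)"
      unfolding Z_def by (intro sum_mono) auto
    then show "exp (- (t * (\<Sum>j\<in>J. Z j S))) \<le> exp (- (t * (\<Sum>j\<in>J. Z j T)))"
      using that by (simp add: mult_left_mono)
  qed
  have key: "?M (\<lambda>S. Z i S * exp (- (t * X S))) \<ge>
      ((\<Prod>e\<in>A i. b e) - t * (\<Sum>j\<in>{j\<in>I. A i \<inter> A j \<noteq> {}}. \<Prod>e\<in>A i \<union> A j. b e)) * \<phi> t"
    if i: "i \<in> I" and t: "0 \<le> t" for i t
  proof -
    define J where "J = {j\<in>I. A i \<inter> A j \<noteq> {}}"
    define N where "N = subset_sum E (\<lambda>e. if e \<in> A i then 0 else a e) b"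
    \<comment> \<open>\<open>F1\<close> collects the sets that meet \<open>A i\<close>,
      \<open>F2\<close> those disjoint from \<open>A i\<close>. Conditioning on the absence of
      \<open>A i\<close>, which is what \<open>N\<close> does up to normalisation, affects only
      \<open>F1\<close>.\<close>
    define F1 F2 where "F1 S = exp (- (t * (\<Sum>j\<in>J. Z j S)))"
      and "F2 S = exp (- (t * (\<Sum>j\<in>I - J. Z j S)))" for S
    define p where "p = (\<Prod>e\<in>A i. b e)"
    have N: "N h = ?M (\<lambda>S. Z i S * h S)" for h
      unfolding N_def Z_def by (rule subset_sum_absent[OF E A[OF i]])
    have p: "0 < p" unfolding p_def using A[OF i] ab(3) by (intro prod_pos) auto
    have X: "exp (- (t * X S)) = F1 S * F2 S" for S
    proof -
      have "X S = (\<Sum>j\<in>J. Z j S) + (\<Sum>j\<in>I - J. Z j S)"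
        unfolding X_def using I by (subst sum.subset_diff[of J]) (auto simp: J_def)
      then show ?thesis by (simp add: F1_def F2_def exp_add[symmetric] algebra_simps)
    qed
    have EA: "E \<inter> A i = A i" using A[OF i] by auto
    have N1: "N (\<lambda>_. 1) = p"
      using subset_sum_prob_absent[OF E A[OF i] ab(1)] by (simp add: N p_def Z_def)
    have N2: "N F2 = p * ?M F2"
    proof -
      have *: "Z j S = Z j (S - A i)" if "j \<in> I - J" for j S
      proof -
        have "A i \<inter> A j = {}" using that by (auto simp: J_def)
        then have "S \<inter> A j = {} \<longleftrightarrow> (S - A i) \<inter> A j = {}" by auto
        then show ?thesis by (simp add: Z_def)
      qed
      have "F2 S = F2 (S - A i)" for S
      proof -
        from * have "(\<Sum>j\<in>I - J. Z j S) = (\<Sum>j\<in>I - J. Z j (S - A i))" by (intro sum.cong refl)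
        then show ?thesis by (simp only: F2_def)
      qed
      from subset_sum_absent_indep[of E a b F2, OF E ab(1) this] show ?thesis
        by (simp add: N_def p_def EA)
    qed
    have F2: "\<phi> t \<le> ?M F2"
      unfolding \<phi>_def
    proof (rule subset_sum_mono)
      fix S
      have "0 \<le> (\<Sum>j\<in>J. Z j S)" by (intro sum_nonneg) (simp add: Z_def)
      then have "F1 S \<le> 1" using t by (simp add: F1_def)
      then show "exp (- (t * X S)) \<le> F2 S"
        by (simp add: X F2_def mult_left_le_one_le F1_def)
    qed (use ab b0 in auto)
    have F1: "p - t * (\<Sum>j\<in>J. \<Prod>e\<in>A i \<union> A j. b e) \<le> N F1"
    proof -
      have "?M (\<lambda>S. Z i S * Z j S) = (\<Prod>e\<in>A i \<union> A j. b e)" if "j \<in> J" for j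
      proof -
        have "Z i S * Z j S = of_bool (S \<inter> (A i \<union> A j) = {})" for S
          by (auto simp: Z_def)
        moreover have "A i \<union> A j \<subseteq> E" using A i that by (auto simp: J_def)
        ultimately show ?thesis using subset_sum_prob_absent[OF E _ ab(1)] by simp
      qed
      then have "p - t * (\<Sum>j\<in>J. \<Prod>e\<in>A i \<union> A j. b e) = N (\<lambda>_. 1) + (- t) * (\<Sum>j\<in>J. ?M (\<lambda>S. Z i S * Z j S))"
        by (simp add: N1)
      also have "(\<Sum>j\<in>J. ?M (\<lambda>S. Z i S * Z j S)) = N (\<lambda>S. \<Sum>j\<in>J. Z j S)"
        by (simp add: N subset_sum_sum[symmetric] sum_distrib_left)
      also have "N (\<lambda>_. 1) + (- t) * N (\<lambda>S. \<Sum>j\<in>J. Z j S) = N (\<lambda>S. 1 + (- t) * (\<Sum>j\<in>J. Z j S))"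
        unfolding N_def by (simp only: subset_sum_add subset_sum_cmult)
      also have "\<dots> \<le> N F1"
        unfolding N_def
      proof (rule subset_sum_mono)
        fix S
        show "1 + (- t) * (\<Sum>j\<in>J. Z j S) \<le> F1 S"
          using exp_ge_add_one_self[of "- (t * (\<Sum>j\<in>J. Z j S))"] by (simp add: F1_def)
      qed (use ab b0 in auto)
      finally show ?thesis .
    qed
    have M1: "0 \<le> \<phi> t"
      unfolding \<phi>_def by (intro subset_sum_nonneg) (use ab b0 in auto)
    have NF1: "0 \<le> N F1"
      unfolding N_def by (intro subset_sum_nonneg) (use ab b0 in \<open>auto simp: F1_def\<close>)
    have "F1 = (\<lambda>S. exp (- (t * (\<Sum>j\<in>J. Z j S))))" "F2 = (\<lambda>S. exp (- (t * (\<Sum>j\<in>I - J. Z j S))))"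
      by (simp_all add: fun_eq_iff F1_def F2_def)
    then have "mono F1" "mono F2" using anti[OF t] by simp_all
    then have "N F1 * N F2 \<le> N (\<lambda>S. F1 S * F2 S) * N (\<lambda>_. 1)"
      unfolding N_def using ab b0 E
      by (intro harris_subset_sum) auto
    then have "N F1 * ?M F2 \<le> N (\<lambda>S. F1 S * F2 S)"
      using p by (simp add: N1 N2)
    moreover have "(p - t * (\<Sum>j\<in>J. \<Prod>e\<in>A i \<union> A j. b e)) * \<phi> t \<le> N F1 * \<phi> t"
      by (rule mult_right_mono[OF F1 M1])
    moreover have "N F1 * \<phi> t \<le> N F1 * ?M F2" by (rule mult_left_mono[OF F2 NF1])
    ultimately have "(p - t * (\<Sum>j\<in>J. \<Prod>e\<in>A i \<union> A j. b e)) * \<phi> t \<le> N (\<lambda>S. F1 S * F2 S)"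
      by linarith
    then show ?thesis by (simp add: N X p_def J_def)
  qed
  have M1: "0 \<le> \<phi> t" for t
    unfolding \<phi>_def by (intro subset_sum_nonneg) (use ab b0 in auto)
  define \<phi>' where "\<phi>' t = - (\<Sum>i\<in>I. ?M (\<lambda>S. Z i S * exp (- (t * X S))))" for t
  have "(\<phi> has_real_derivative ?M (\<lambda>S. - X S * exp (- (t * X S)))) (at t)" for t
    unfolding \<phi>_def subset_sum_def by (auto intro!: derivative_eq_intros sum.cong)
  moreover have "?M (\<lambda>S. - X S * exp (- (t * X S))) = \<phi>' t" for t
  proof -
    have "?M (\<lambda>S. - X S * exp (- (t * X S))) = - ?M (\<lambda>S. \<Sum>i\<in>I. Z i S * exp (- (t * X S)))"
      using subset_sum_cmult[of E a b "-1" "\<lambda>S. X S * exp (- (t * X S))"]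
      by (simp add: X_def sum_distrib_right)
    then show ?thesis by (simp add: subset_sum_sum \<phi>'_def)
  qed
  ultimately have deriv: "(\<phi> has_real_derivative \<phi>' t) (at t)" for t by simp
  have \<phi>': "\<phi>' t \<le> - ((\<mu> - t * D) * \<phi> t)" if t: "0 \<le> t" for t
  proof -
    let ?D = "\<Sum>i\<in>I. \<Sum>j\<in>{j\<in>I. A i \<inter> A j \<noteq> {}}. \<Prod>e\<in>A i \<union> A j. b e"
    have "(\<mu> - t * D) * \<phi> t \<le> (\<mu> - t * ?D) * \<phi> t"
      using D t by (intro mult_right_mono M1) (simp add: mult_left_mono)
    also have "\<dots> = (\<Sum>i\<in>I. ((\<Prod>e\<in>A i. b e) - t * (\<Sum>j\<in>{j\<in>I. A i \<inter> A j \<noteq> {}}. \<Prod>e\<in>A i \<union> A j. b e)) * \<phi> t)"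
      unfolding mu by (simp only: sum_distrib_left[of t] sum_subtractf[symmetric] sum_distrib_right)
    also have "\<dots> \<le> - \<phi>' t"
      unfolding \<phi>'_def by (simp, intro sum_mono key t)
    finally show ?thesis by simp
  qed
  \<comment> \<open>The extra exponential is the integrating factor of \<phi>' = - (\<mu> - t D)
    \<phi>, so the differential inequality says that \<open>\<psi>\<close> does not increase on the
    nonnegative half-line.\<close>
  define \<psi> where "\<psi> t = \<phi> t * exp (\<mu> * t - t\<^sup>2 * D / 2)" for t
  have d\<psi>: "(\<psi> has_real_derivative (\<phi>' t + (\<mu> - t * D) * \<phi> t) * exp (\<mu> * t - t\<^sup>2 * D / 2)) (at t)" for t
    unfolding \<psi>_def by (rule derivative_eq_intros deriv refl | simp add: algebra_simps)+
  \<comment> \<open>This value maximises \<mu> t - t^2 D / 2.\<close>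
  define t where "t = \<mu> / D"
  have mu0: "0 \<le> \<mu>" unfolding mu using A b0 by (auto intro!: sum_nonneg prod_nonneg)
  have t0: "0 \<le> t" using mu0 D by (simp add: t_def)
  have "\<psi> t \<le> \<psi> 0"
  proof (rule DERIV_nonpos_imp_nonincreasing[OF t0])
    fix x assume "0 \<le> x" "x \<le> t"
    then show "\<exists>y. (\<psi> has_real_derivative y) (at x) \<and> y \<le> 0"
      using d\<psi>[of x] \<phi>'[of x] by (intro exI conjI) (auto simp: mult_le_0_iff)
  qed
  also have "\<psi> 0 = 1"
    unfolding \<psi>_def \<phi>_def using subset_sum_const[OF E, of a b 1] ab(1) by simp
  finally have "\<phi> t * exp (\<mu> * t - t\<^sup>2 * D / 2) \<le> 1" by (simp add: \<psi>_def)
  then have "\<phi> t \<le> exp (- (\<mu> * t - t\<^sup>2 * D / 2))"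
    by (simp add: exp_minus field_simps)
  also have "\<mu> * t - t\<^sup>2 * D / 2 = \<mu>\<^sup>2 / (2 * D)"
    using D by (simp add: t_def field_simps power2_eq_square)
  finally have "\<phi> t \<le> exp (- (\<mu>\<^sup>2 / (2 * D)))" .
  \<comment> \<open>If no \<open>A i\<close> is absent then \<open>X S = 0\<close>, and the
    exponential is 1.\<close>
  moreover have "?M (\<lambda>S. of_bool (\<forall>i\<in>I. S \<inter> A i \<noteq> {})) \<le> \<phi> t"
    unfolding \<phi>_def
  proof (rule subset_sum_mono)
    fix S
    show "of_bool (\<forall>i\<in>I. S \<inter> A i \<noteq> {}) \<le> exp (- (t * X S))"
      by (cases "\<forall>i\<in>I. S \<inter> A i \<noteq> {}") (simp_all add: X_def Z_def)
  qed (use ab b0 in auto)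
  ultimately show ?thesis by linarith
qed

section \<open>Independent sets in the random block graph\<close>

text \<open>The smaller vertex comes first, as in the sample space of
  \<open>random_block_graph\<close>, so each unordered pair occurs once.\<close>

definition edge_pairs :: "nat set \<Rightarrow> (nat \<times> nat) set" where
  "edge_pairs S = {(u, v). u \<in> S \<and> v \<in> S \<and> u < v}"

definition indep_set :: "'v set set \<Rightarrow> 'v set \<Rightarrow> bool" where
  "indep_set E S \<longleftrightarrow> (\<forall>u\<in>S. \<forall>v\<in>S. u \<noteq> v \<longrightarrow> {u, v} \<notin> E)"

definition graph_of :: "(nat \<times> nat) set \<Rightarrow> nat set set" where
  "graph_of T = {{u, v} |u v. (u, v) \<in> T}"

text \<open>The probability of a non-edge is exp (- \<open>wt\<close>), which turns probabilities of
  independence into exponentials of a quadratic form with positive coefficients.\<close>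

definition wt :: "real ^ 'k ^ 'k \<Rightarrow> 'k \<Rightarrow> 'k \<Rightarrow> real" where
  "wt P i j = - ln (1 - P $ i $ j)"

definition quad :: "real ^ 'k ^ 'k \<Rightarrow> real ^ 'k \<Rightarrow> real" where
  "quad P x = (\<Sum>i\<in>UNIV. \<Sum>j\<in>UNIV. x $ i * x $ j * wt P i j)"

definition profile :: "(nat \<Rightarrow> 'k) \<Rightarrow> nat set \<Rightarrow> real ^ 'k" where
  "profile b S = (\<chi> i. real (card {v \<in> S. b v = i}))"

lemma finite_edge_pairs [simp]: "finite S \<Longrightarrow> finite (edge_pairs S)"
  by (rule finite_subset[of _ "S \<times> S"]) (auto simp: edge_pairs_def)

lemma edge_pairs_Int: "edge_pairs S \<inter> edge_pairs T = edge_pairs (S \<inter> T)"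
  by (auto simp: edge_pairs_def)

lemma edge_pairs_mono: "S \<subseteq> T \<Longrightarrow> edge_pairs S \<subseteq> edge_pairs T"
  by (auto simp: edge_pairs_def)

lemma indep_set_subset: "indep_set E T \<Longrightarrow> S \<subseteq> T \<Longrightarrow> indep_set E S"
  by (auto simp: indep_set_def)

lemma indep_set_graph_of:
  assumes "T \<subseteq> edge_pairs V"
  shows "indep_set (graph_of T) S \<longleftrightarrow> T \<inter> edge_pairs S = {}"
proof
  assume l: "indep_set (graph_of T) S"
  show "T \<inter> edge_pairs S = {}"
  proof (rule ccontr)
    assume "T \<inter> edge_pairs S \<noteq> {}"
    then obtain u v where "(u, v) \<in> T" "u \<in> S" "v \<in> S" "u < v" by (auto simp: edge_pairs_def)
    then show False using l by (auto simp: indep_set_def graph_of_def)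
  qed
next
  assume r: "T \<inter> edge_pairs S = {}"
  show "indep_set (graph_of T) S"
    unfolding indep_set_def
  proof (intro ballI impI notI)
    fix u v assume uv: "u \<in> S" "v \<in> S" "u \<noteq> v" "{u, v} \<in> graph_of T"
    then obtain x y where xy: "{u, v} = {x, y}" "(x, y) \<in> T" by (auto simp: graph_of_def)
    then have "x < y" "x \<in> S" "y \<in> S" using uv assms by (auto simp: edge_pairs_def doubleton_eq_iff)
    then have "(x, y) \<in> edge_pairs S" by (simp add: edge_pairs_def)
    then show False using xy r by auto
  qed
qed

text \<open>Translates the product measure into the finite sums of the previous section: almost
  surely \<open>f\<close> is false outside \<open>D\<close>, and such functions correspond to the
  subsets of \<open>D\<close>.\<close>

lemma prob_Pi_pmf_bernoulli:
  assumes D: "finite D" and p: "\<And>e. e \<in> D \<Longrightarrow> 0 \<le> p e \<and> p e \<le> 1"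
  shows "measure_pmf.prob (Pi_pmf D False (\<lambda>e. bernoulli_pmf (p e))) {f. Q {e \<in> D. f e}} =
    subset_sum D p (\<lambda>e. 1 - p e) (\<lambda>S. of_bool (Q S))"
proof -
  let ?M = "Pi_pmf D False (\<lambda>e. bernoulli_pmf (p e))"
  define X where "X = (\<lambda>S e. e \<in> S) ` {S \<in> Pow D. Q S}"
  have "measure_pmf.prob ?M {f. Q {e \<in> D. f e}} = measure_pmf.prob ?M X"
  proof (rule measure_pmf.finite_measure_eq_AE)
    show "AE f in measure_pmf ?M. (f \<in> {f. Q {e \<in> D. f e}}) = (f \<in> X)"
      unfolding AE_measure_pmf_iff
    proof
      fix f assume fM: "f \<in> set_pmf ?M"
      have f: "\<And>x. x \<notin> D \<Longrightarrow> \<not> f x" using subsetD[OF set_Pi_pmf_subset[OF D] fM] by simp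
      then have f': "f = (\<lambda>e. e \<in> {e \<in> D. f e})" by (intro ext) auto
      have "Q {e \<in> D. f e}" if "f \<in> X"
      proof -
        obtain S where S: "S \<subseteq> D" "Q S" "f = (\<lambda>e. e \<in> S)" using \<open>f \<in> X\<close> by (auto simp: X_def)
        then have "{e \<in> D. f e} = S" by auto
        then show ?thesis using S by simp
      qed
      moreover have "f \<in> X" if "Q {e \<in> D. f e}"
        unfolding X_def by (rule image_eqI[where x = "{e \<in> D. f e}"], rule f') (use that in auto)
      ultimately show "(f \<in> {f. Q {e \<in> D. f e}}) = (f \<in> X)" by auto
    qed
  qed auto
  also have "\<dots> = sum (pmf ?M) X"
    using D by (intro measure_measure_pmf_finite) (simp add: X_def)
  also have "\<dots> = (\<Sum>S\<in>{S \<in> Pow D. Q S}. pmf ?M (\<lambda>e. e \<in> S))"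
    unfolding X_def by (subst sum.reindex) (auto simp: inj_on_def fun_eq_iff)
  also have "\<dots> = (\<Sum>S\<in>{S \<in> Pow D. Q S}. (\<Prod>e\<in>S. p e) * (\<Prod>e\<in>D - S. 1 - p e))"
  proof (rule sum.cong[OF refl])
    fix S assume S: "S \<in> {S \<in> Pow D. Q S}"
    then have "pmf ?M (\<lambda>e. e \<in> S) = (\<Prod>e\<in>D. pmf (bernoulli_pmf (p e)) (e \<in> S))"
      using D by (subst pmf_Pi) auto
    also have "\<dots> = (\<Prod>e\<in>D. if e \<in> S then p e else 1 - p e)"
      using p by (intro prod.cong refl) (auto simp: pmf_bernoulli_True pmf_bernoulli_False)
    also have "\<dots> = (\<Prod>e\<in>D - S. if e \<in> S then p e else 1 - p e) * (\<Prod>e\<in>S. if e \<in> S then p e else 1 - p e)"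
      using S D by (intro prod.subset_diff) auto
    also have "\<dots> = (\<Prod>e\<in>S. p e) * (\<Prod>e\<in>D - S. 1 - p e)"
      by (subst mult.commute, intro arg_cong2[where f = "(*)"] prod.cong) auto
    finally show "pmf ?M (\<lambda>e. e \<in> S) = (\<Prod>e\<in>S. p e) * (\<Prod>e\<in>D - S. 1 - p e)" .
  qed
  also have "\<dots> = subset_sum D p (\<lambda>e. 1 - p e) (\<lambda>S. of_bool (Q S))"
    unfolding subset_sum_def using D by (intro sum.mono_neutral_cong_left) auto
  finally show ?thesis .
qed

text \<open>\<open>C\<close> is a uniform bound on the weights, for the crude estimates in which the
  individual weights do not matter.\<close>

locale block_model =
  fixes P :: "real ^ 'k ^ 'k" and C :: real
  assumes sym: "transpose P = P" and P: "\<And>i j. 0 < P $ i $ j \<and> P $ i $ j < 1"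
    and C: "\<And>i j. wt P i j \<le> C"
begin

lemma wt_sym: "wt P i j = wt P j i"
proof -
  have "P $ i $ j = transpose P $ i $ j" by (simp only: sym)
  then show ?thesis by (simp add: wt_def transpose_def)
qed

lemma wt_pos: "0 < wt P i j"
  using P[of i j] by (simp add: wt_def)

lemma C_pos: "0 < C"
  by (rule less_le_trans[OF wt_pos[of undefined undefined] C])

lemma exp_wt: "exp (- wt P i j) = 1 - P $ i $ j"
  using P[of i j] by (simp add: wt_def)

definition indep_prob :: "(nat \<Rightarrow> 'k) \<Rightarrow> nat set \<Rightarrow> real" where
  "indep_prob b S = (\<Prod>e\<in>edge_pairs S. 1 - P $ b (fst e) $ b (snd e))"

lemma prob_random_block_graph:
  "measure_pmf.prob (random_block_graph n b P) {E. Q E} =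
    subset_sum (edge_pairs {..<n}) (\<lambda>e. P $ b (fst e) $ b (snd e)) (\<lambda>e. 1 - P $ b (fst e) $ b (snd e))
      (\<lambda>T. of_bool (Q (graph_of T)))"
proof -
  have D: "{e. fst e < snd e \<and> snd e < n} = edge_pairs {..<n}" by (auto simp: edge_pairs_def)
  have "{{u, v} |u v. u < v \<and> v < n \<and> f (u, v)} = graph_of {e \<in> edge_pairs {..<n}. f e}" for f
    unfolding graph_of_def edge_pairs_def by (intro Collect_cong) (auto, metis less_trans)
  then have "measure_pmf.prob (random_block_graph n b P) {E. Q E} =
    measure_pmf.prob (Pi_pmf (edge_pairs {..<n}) False (\<lambda>e. bernoulli_pmf (P $ b (fst e) $ b (snd e))))
      {f. Q (graph_of {e \<in> edge_pairs {..<n}. f e})}"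
    unfolding random_block_graph_def measure_map_pmf vimage_def case_prod_unfold by (simp add: D)
  also have "\<dots> = subset_sum (edge_pairs {..<n}) (\<lambda>e. P $ b (fst e) $ b (snd e)) (\<lambda>e. 1 - P $ b (fst e) $ b (snd e))
      (\<lambda>T. of_bool (Q (graph_of T)))"
  proof (rule prob_Pi_pmf_bernoulli)
    show "0 \<le> P $ b (fst e) $ b (snd e) \<and> P $ b (fst e) $ b (snd e) \<le> 1" for e
      using P[of "b (fst e)" "b (snd e)"] by simp
  qed simp
  finally show ?thesis .
qed

lemma prob_indep_set:
  assumes "S \<subseteq> {..<n}"
  shows "measure_pmf.prob (random_block_graph n b P) {E. indep_set E S} = indep_prob b S"
proof -
  have "measure_pmf.prob (random_block_graph n b P) {E. indep_set E S} =
    subset_sum (edge_pairs {..<n}) (\<lambda>e. P $ b (fst e) $ b (snd e)) (\<lambda>e. 1 - P $ b (fst e) $ b (snd e))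
      (\<lambda>T. of_bool (T \<inter> edge_pairs S = {}))"
    unfolding prob_random_block_graph
    by (intro subset_sum_cong) (auto simp: indep_set_graph_of)
  also have "\<dots> = indep_prob b S"
    unfolding indep_prob_def using assms by (intro subset_sum_prob_absent) (auto simp: edge_pairs_mono)
  finally show ?thesis .
qed

lemma sum_by_block:
  fixes h :: "'k \<Rightarrow> real" and b :: "nat \<Rightarrow> 'k"
  assumes "finite S"
  shows "(\<Sum>v\<in>S. h (b v)) = (\<Sum>i\<in>UNIV. profile b S $ i * h i)"
proof -
  have "(\<Sum>v\<in>S. h (b v)) = (\<Sum>i\<in>UNIV. \<Sum>v\<in>{v\<in>S. b v = i}. h (b v))"
    using assms by (subst sum.group[of S UNIV b "\<lambda>v. h (b v)"]) auto
  also have "\<dots> = (\<Sum>i\<in>UNIV. profile b S $ i * h i)"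
    by (intro sum.cong refl) (simp add: profile_def)
  finally show ?thesis .
qed

lemma sum_profile:
  fixes b :: "nat \<Rightarrow> 'k"
  shows "finite S \<Longrightarrow> (\<Sum>i\<in>UNIV. profile b S $ i) = real (card S)"
  using sum_by_block[of S "\<lambda>_. 1" b] by simp

text \<open>\<open>quad\<close> sums the weights over all ordered pairs in
  \<open>S \<times> S\<close>. These split into \<open>edge_pairs S\<close>, its mirror image with
  the same sum by symmetry of \<open>P\<close>, and the diagonal, which has to be subtracted before
  halving.\<close>

lemma indep_prob_eq:
  assumes S: "finite S"
  shows "indep_prob b S = exp (- (quad P (profile b S) - (\<Sum>i\<in>UNIV. profile b S $ i * wt P i i)) / 2)"
proof -
  let ?w = "\<lambda>u v. wt P (b u) (b v)"
  define U where "U = (\<Sum>e\<in>edge_pairs S. ?w (fst e) (snd e))"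
  have "(\<Sum>u\<in>S. \<Sum>v\<in>S. ?w u v) = (\<Sum>e\<in>S \<times> S. ?w (fst e) (snd e))"
    by (simp add: sum.cartesian_product case_prod_beta')
  also have "S \<times> S = (edge_pairs S \<union> prod.swap ` edge_pairs S) \<union> (\<lambda>u. (u, u)) ` S"
    by (auto simp: edge_pairs_def image_iff)
  also have "(\<Sum>e\<in>\<dots>. ?w (fst e) (snd e)) =
      (\<Sum>e\<in>edge_pairs S \<union> prod.swap ` edge_pairs S. ?w (fst e) (snd e)) + (\<Sum>e\<in>(\<lambda>u. (u, u)) ` S. ?w (fst e) (snd e))"
    using S by (intro sum.union_disjoint finite_UnI finite_imageI finite_edge_pairs) (auto simp: edge_pairs_def)
  also have "(\<Sum>e\<in>edge_pairs S \<union> prod.swap ` edge_pairs S. ?w (fst e) (snd e)) =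
      U + (\<Sum>e\<in>prod.swap ` edge_pairs S. ?w (fst e) (snd e))"
    unfolding U_def using S
    by (intro sum.union_disjoint finite_imageI finite_edge_pairs) (auto simp: edge_pairs_def)
  also have "(\<Sum>e\<in>prod.swap ` edge_pairs S. ?w (fst e) (snd e)) = U"
    unfolding U_def by (subst sum.reindex) (auto simp: wt_sym inj_on_def)
  also have "(\<Sum>e\<in>(\<lambda>u. (u, u)) ` S. ?w (fst e) (snd e)) = (\<Sum>i\<in>UNIV. profile b S $ i * wt P i i)"
    using sum_by_block[OF S, of "\<lambda>i. wt P i i" b] by (subst sum.reindex) (auto simp: inj_on_def)
  also have "(\<Sum>u\<in>S. \<Sum>v\<in>S. ?w u v) = quad P (profile b S)"
    unfolding quad_def by (simp add: sum_by_block[OF S] sum_distrib_left mult.assoc)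
      (simp add: sum_by_block[OF S, of "\<lambda>i. \<Sum>j\<in>UNIV. profile b S $ j * wt P i j"] sum_distrib_left)
  finally have U: "U = (quad P (profile b S) - (\<Sum>i\<in>UNIV. profile b S $ i * wt P i i)) / 2" by simp
  have "indep_prob b S = exp (- U)"
    unfolding indep_prob_def U_def using S by (simp add: exp_wt[symmetric] exp_sum sum_negf[symmetric])
  then show ?thesis by (simp only: U minus_divide_left)
qed

lemma indep_prob_pos: "finite S \<Longrightarrow> 0 < indep_prob b S"
  by (simp add: indep_prob_eq)

text \<open>The diagonal correction is only linear in \<open>card S\<close>, of lower order than the
  quadratic form for sets whose size is of order ln n.\<close>

lemma indep_prob_upper:
  assumes "finite S"
  shows "indep_prob b S \<le> exp (- (quad P (profile b S) - C * real (card S)) / 2)"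
proof -
  have "(\<Sum>i\<in>UNIV. profile b S $ i * wt P i i) \<le> (\<Sum>i\<in>UNIV. profile b S $ i * C)"
    by (intro sum_mono mult_left_mono C) (simp add: profile_def)
  also have "\<dots> = C * card S"
    by (simp add: sum_profile[OF assms, of b, symmetric] sum_distrib_left mult.commute)
  finally show ?thesis by (simp add: indep_prob_eq[OF assms])
qed

lemma indep_prob_lower:
  assumes "finite S"
  shows "exp (- quad P (profile b S) / 2) \<le> indep_prob b S"
proof -
  have "0 \<le> (\<Sum>i\<in>UNIV. profile b S $ i * wt P i i)"
    by (intro sum_nonneg mult_nonneg_nonneg less_imp_le[OF wt_pos]) (simp add: profile_def)
  then show ?thesis by (simp add: indep_prob_eq[OF assms])
qed

lemma quad_profile_le:
  assumes "finite S"
  shows "quad P (profile b S) \<le> C * (real (card S))\<^sup>2"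
proof -
  have "quad P (profile b S) \<le> (\<Sum>i\<in>UNIV. \<Sum>j\<in>UNIV. profile b S $ i * profile b S $ j * C)"
    unfolding quad_def by (intro sum_mono mult_left_mono C) (simp add: profile_def)
  also have "\<dots> = C * (\<Sum>i\<in>UNIV. profile b S $ i) * (\<Sum>j\<in>UNIV. profile b S $ j)"
    by (simp add: sum_product sum_distrib_left sum_distrib_right mult_ac)
  finally show ?thesis by (simp add: sum_profile[OF assms] power2_eq_square mult_ac)
qed

lemma g_eq: "g P c I = (\<Sum>i\<in>I. c $ i) - (\<Sum>i\<in>I. \<Sum>j\<in>I. c $ i * c $ j * wt P i j) / 2"
  by (simp add: g_def wt_def sum_negf)

lemma g_UNIV: "g P c UNIV = (\<Sum>i\<in>UNIV. c $ i) - quad P c / 2"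
  by (simp add: g_eq quad_def)

text \<open>First moment bound. The condition on \<open>S\<close> says that g is negative at
  \<theta> times its profile, for the full index set; it makes \<open>S\<close> independent with
  probability at most \<open>x ^ card S\<close>, where
  \<open>x = exp (C / 2 - 1 / \<theta>)\<close>. Summing over all nonempty subsets gives the
  binomial expression.\<close>

lemma prob_large_indep_set_le:
  assumes \<theta>: "0 < \<theta>"
  shows "measure_pmf.prob (random_block_graph n b P)
     {E. \<exists>S\<subseteq>{..<n}. S \<noteq> {} \<and> indep_set E S \<and> real (card S) < \<theta> / 2 * quad P (profile b S)}
     \<le> (1 + exp (C / 2 - 1 / \<theta>)) ^ n - 1"
proof -
  let ?p = "measure_pmf.prob (random_block_graph n b P)"
  define B where "B = {S \<in> Pow {..<n}. S \<noteq> {} \<and> real (card S) < \<theta> / 2 * quad P (profile b S)}"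
  define x where "x = exp (C / 2 - 1 / \<theta>)"
  have B: "finite B" by (simp add: B_def)
  have "?p {E. \<exists>S\<subseteq>{..<n}. S \<noteq> {} \<and> indep_set E S \<and> real (card S) < \<theta> / 2 * quad P (profile b S)}
      = ?p (\<Union>S\<in>B. {E. indep_set E S})"
    by (intro arg_cong[where f = ?p]) (auto simp: B_def)
  also have "\<dots> \<le> (\<Sum>S\<in>B. ?p {E. indep_set E S})"
    by (intro measure_pmf.finite_measure_subadditive_finite B) auto
  also have "\<dots> \<le> (\<Sum>S\<in>B. x ^ card S)"
  proof (intro sum_mono)
    fix S assume "S \<in> B"
    then have S: "S \<subseteq> {..<n}" "finite S" "real (card S) < \<theta> / 2 * quad P (profile b S)"
      by (auto simp: B_def intro: finite_subset)
    have "?p {E. indep_set E S} \<le> exp (- (quad P (profile b S) - C * real (card S)) / 2)"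
      using indep_prob_upper[OF S(2)] by (simp add: prob_indep_set[OF S(1)])
    also have "\<dots> \<le> exp (real (card S) * (C / 2 - 1 / \<theta>))"
      using S(3) \<theta> by (simp add: field_simps)
    also have "\<dots> = x ^ card S" by (simp add: x_def exp_of_nat_mult)
    finally show "?p {E. indep_set E S} \<le> x ^ card S" .
  qed
  also have "\<dots> \<le> (\<Sum>S\<in>Pow {..<n} - {{}}. x ^ card S)"
    by (intro sum_mono2) (auto simp: B_def x_def)
  also have "\<dots> = (1 + x) ^ n - 1"
    by (subst sum_diff) (auto simp: sum_Pow_power_card)
  finally show ?thesis by (simp add: x_def)
qed

end

section \<open>The admissible set and the lower bound\<close>

context block_model
begin

lemma g_cong: "(\<And>i. i \<in> I \<Longrightarrow> c $ i = d $ i) \<Longrightarrow> g P c I = g P d I"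
  unfolding g_eq by (intro arg_cong2[where f = "(-)"] arg_cong2[where f = "(/)"] sum.cong refl) auto

text \<open>Isolates one coordinate: \<open>g\<close> is a concave quadratic function of
  \<open>c $ i\<close>.\<close>

lemma g_insert:
  assumes "i \<notin> J"
  shows "g P c (insert i J) = g P c J + c $ i * (1 - (\<Sum>j\<in>J. c $ j * wt P i j)) - (c $ i)\<^sup>2 * wt P i i / 2"
proof -
  have J: "finite J" by simp
  have "(\<Sum>l\<in>insert i J. \<Sum>j\<in>insert i J. c $ l * c $ j * wt P l j) =
    (c $ i)\<^sup>2 * wt P i i + (\<Sum>j\<in>J. c $ i * c $ j * wt P i j) + (\<Sum>l\<in>J. c $ l * c $ i * wt P l i)
      + (\<Sum>l\<in>J. \<Sum>j\<in>J. c $ l * c $ j * wt P l j)"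
    using assms J by (simp add: sum.distrib power2_eq_square)
  also have "(\<Sum>l\<in>J. c $ l * c $ i * wt P l i) = c $ i * (\<Sum>j\<in>J. c $ j * wt P i j)"
    by (simp add: sum_distrib_left wt_sym[of _ i] mult_ac)
  also have "(\<Sum>j\<in>J. c $ i * c $ j * wt P i j) = c $ i * (\<Sum>j\<in>J. c $ j * wt P i j)"
    by (simp add: sum_distrib_left mult_ac)
  finally show ?thesis
    using assms J by (simp add: g_eq field_simps)
qed

text \<open>For index sets containing \<open>i\<close>, \<open>g\<close> is concave in the
  \<open>i\<close>-th coordinate and nonnegative at both ends of the interval from 0 to
  \<open>c $ i\<close>: at 0 it reduces to the constraint for the index set without
  \<open>i\<close>. Hence it is nonnegative in between. The other constraints do not change.\<close>

lemma admissible_update: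
  assumes c: "c \<in> admissible P" and x: "0 \<le> x" "x \<le> c $ i"
  shows "(\<chi> j. if j = i then x else c $ j) \<in> admissible P"
proof -
  let ?d = "\<chi> j. if j = i then x else c $ j"
  have c0: "0 \<le> c $ j" and cg: "I \<noteq> {} \<Longrightarrow> 0 \<le> g P c I" for j I
    using c by (auto simp: admissible_def)
  \<comment> \<open>The empty index set is included because removing \<open>i\<close> from
    \<open>I\<close> may leave nothing.\<close>
  have cg': "0 \<le> g P c I" for I
    using cg[of I] by (cases "I = {}") (auto simp: g_def)
  have "0 \<le> g P ?d I" for I
  proof (cases "i \<in> I")
    case False
    then have "g P ?d I = g P c I" by (intro g_cong) auto
    then show ?thesis using cg' by simp
  next
    case True
    define J where "J = I - {i}"
    have I: "I = insert i J" "i \<notin> J" using True by (auto simp: J_def)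
    define B where "B = 1 - (\<Sum>j\<in>J. c $ j * wt P i j)"
    define y where "y = c $ i"
    define w where "w = wt P i i"
    have gd: "g P ?d J = g P c J" using I by (intro g_cong) auto
    have s: "(\<Sum>j\<in>J. ?d $ j * wt P i j) = (\<Sum>j\<in>J. c $ j * wt P i j)"
      using I by (intro sum.cong) auto
    have e: "g P ?d I = g P c J + x * B - x\<^sup>2 * w / 2"
      unfolding I(1) g_insert[OF I(2)] gd s by (simp add: B_def w_def)
    have f: "0 \<le> g P c J + y * B - y\<^sup>2 * w / 2"
      using cg'[of I] unfolding I(1) g_insert[OF I(2)] by (simp add: B_def w_def y_def)
    show ?thesis
    proof (cases "y = 0")
      case True
      then have "x = 0" using x by (simp add: y_def)
      then show ?thesis using e cg'[of J] by simp
    next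
      case False
      then have y: "0 < y" using c0[of i] by (simp add: y_def)
      define \<theta> where "\<theta> = x / y"
      have \<theta>: "0 \<le> \<theta>" "\<theta> \<le> 1" "x = \<theta> * y"
        using x y by (auto simp: \<theta>_def y_def)
      have "0 \<le> (1 - \<theta>) * g P c J + \<theta> * (g P c J + y * B - y\<^sup>2 * w / 2)"
        using \<theta> cg'[of J] f by (intro add_nonneg_nonneg mult_nonneg_nonneg) auto
      also have "\<dots> = g P c J + \<theta> * y * B - \<theta> * (y\<^sup>2 * w / 2)" by (simp add: algebra_simps)
      also have "\<dots> \<le> g P c J + \<theta> * y * B - \<theta>\<^sup>2 * (y\<^sup>2 * w / 2)"
      proof -
        have "\<theta>\<^sup>2 \<le> \<theta>" using \<theta> by (simp add: power2_eq_square mult_left_le_one_le)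
        then show ?thesis using wt_pos[of i i] by (simp add: mult_right_mono w_def)
      qed
      also have "\<dots> = g P c J + x * B - x\<^sup>2 * w / 2"
        by (simp add: \<theta>(3) power_mult_distrib)
      also note e[symmetric]
      finally show ?thesis .
    qed
  qed
  then show ?thesis using c0 x by (auto simp: admissible_def)
qed

text \<open>Lowers the coordinates one at a time with \<open>admissible_update\<close>;
  \<open>F\<close> is the set of coordinates already lowered.\<close>

lemma admissible_mono:
  assumes c: "c \<in> admissible P" and d: "\<And>i. 0 \<le> d $ i" "\<And>i. d $ i \<le> c $ i"
  shows "d \<in> admissible P"
proof -
  have "(\<chi> j. if j \<in> F then d $ j else c $ j) \<in> admissible P" if "finite F" for F :: "'k set"
    using that
  proof (induction F)
    case empty
    then show ?case using c by simp
  next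
    case (insert i F)
    have "(\<chi> j. if j = i then d $ i else (\<chi> j. if j \<in> F then d $ j else c $ j) $ j) \<in> admissible P"
      using insert d by (intro admissible_update) auto
    also have "(\<chi> j. if j = i then d $ i else (\<chi> j. if j \<in> F then d $ j else c $ j) $ j) =
        (\<chi> j. if j \<in> insert i F then d $ j else c $ j)"
      by (simp add: vec_eq_iff)
    finally show ?case .
  qed
  from this[of UNIV] show ?thesis by simp
qed

text \<open>Multiplying each coordinate by a fixed factor in [0, 1] is a linear map that sends the
  admissible set into itself, hence also its convex hull. Such a map takes \<open>x\<close> to
  \<open>y\<close>.\<close>

lemma convex_hull_admissible_mono:
  assumes x: "x \<in> convex hull (admissible P)" and y: "\<And>i. 0 \<le> y $ i" "\<And>i. y $ i \<le> x $ i"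
  shows "y \<in> convex hull (admissible P)"
proof -
  \<comment> \<open>If \<open>x $ i = 0\<close> then \<open>y $ i = 0\<close> too, so the factor 0
    is correct there.\<close>
  define \<theta> where "\<theta> i = (if x $ i = 0 then 0 else y $ i / x $ i)" for i
  define f where "f z = (\<chi> i. \<theta> i * z $ i)" for z :: "real ^ 'k"
  have \<theta>: "0 \<le> \<theta> i" "\<theta> i \<le> 1" for i
    using y[of i] by (auto simp: \<theta>_def divide_le_eq_1)
  have "linear f"
    by (rule linearI) (simp_all add: f_def vec_eq_iff algebra_simps)
  moreover have "f ` admissible P \<subseteq> admissible P"
  proof
    fix z assume "z \<in> f ` admissible P"
    then obtain c where c: "c \<in> admissible P" "z = f c" by auto
    then have "0 \<le> c $ i" for i by (auto simp: admissible_def)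
    then show "z \<in> admissible P"
      using c \<theta> by (intro admissible_mono[OF c(1)]) (auto simp: f_def mult_left_le_one_le)
  qed
  ultimately have "f ` (convex hull (admissible P)) \<subseteq> convex hull (admissible P)"
    by (simp add: convex_hull_linear_image hull_mono)
  moreover have "y = f x"
  proof -
    have "y $ i = \<theta> i * x $ i" for i using y[of i] by (auto simp: \<theta>_def)
    then show ?thesis by (simp add: f_def vec_eq_iff)
  qed
  ultimately show ?thesis using x by auto
qed

text \<open>The entries of \<open>\<alpha>\<close> are nonnegative with sum 1, so the parameter
  along the ray is the 1-norm that \<open>cstar\<close> maximises.\<close>

lemma cstar_ge:
  assumes \<alpha>: "\<And>i. 0 \<le> \<alpha> $ i" "(\<Sum>i\<in>UNIV. \<alpha> $ i) = 1" and t: "0 \<le> t" "t *\<^sub>R \<alpha> \<in> convex hull (admissible P)"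
  shows "t \<le> cstar \<alpha> P"
proof -
  have "one_norm (t *\<^sub>R \<alpha>) = t"
    using \<alpha> t by (simp add: one_norm_def abs_mult sum_distrib_left[symmetric])
  then have "t \<in> cstar_values \<alpha> P"
    unfolding cstar_values_def using t by (intro image_eqI[of _ _ "t *\<^sub>R \<alpha>"]) auto
  then show ?thesis by (rule cstar_is_max(2)[OF P])
qed

lemma cstar_mem:
  assumes \<alpha>: "\<And>i. 0 \<le> \<alpha> $ i" "(\<Sum>i\<in>UNIV. \<alpha> $ i) = 1"
  shows "cstar \<alpha> P *\<^sub>R \<alpha> \<in> convex hull (admissible P)"
proof -
  have "cstar \<alpha> P \<in> cstar_values \<alpha> P" by (rule cstar_is_max(1)[OF P])
  then obtain t where t: "0 \<le> t" "t *\<^sub>R \<alpha> \<in> convex hull (admissible P)" "cstar \<alpha> P = one_norm (t *\<^sub>R \<alpha>)"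
    by (auto simp: cstar_values_def)
  moreover have "one_norm (t *\<^sub>R \<alpha>) = t"
    using \<alpha> t by (simp add: one_norm_def abs_mult sum_distrib_left[symmetric])
  ultimately show ?thesis by simp
qed

lemma cstar_pos:
  assumes \<alpha>: "\<And>i. 0 \<le> \<alpha> $ i" "(\<Sum>i\<in>UNIV. \<alpha> $ i) = 1"
  shows "0 < cstar \<alpha> P"
proof -
  \<comment> \<open>With this choice \<open>t * wt P i j \<le> 1\<close>. As partial sums of
    \<open>\<alpha>\<close> are at most 1, the quadratic part of \<open>g\<close> at t \<alpha> is
    at most the linear part even before it is halved.\<close>
  define t where "t = 1 / C"
  have t: "0 < t" "t * C = 1" using C_pos by (auto simp: t_def)
  have "0 \<le> g P (t *\<^sub>R \<alpha>) I" for I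
  proof -
    have "(\<Sum>i\<in>I. \<Sum>j\<in>I. (t *\<^sub>R \<alpha>) $ i * (t *\<^sub>R \<alpha>) $ j * wt P i j)
        \<le> (\<Sum>i\<in>I. \<Sum>j\<in>I. (t * \<alpha> $ i) * (\<alpha> $ j))"
    proof (intro sum_mono)
      fix i j
      have "t * wt P i j \<le> 1" using C[of i j] t(1) t(2) by (metis less_imp_le mult_left_mono)
      then have "(t * \<alpha> $ i * \<alpha> $ j) * (t * wt P i j) \<le> (t * \<alpha> $ i * \<alpha> $ j) * 1"
        using \<alpha> t by (intro mult_left_mono) auto
      then show "(t *\<^sub>R \<alpha>) $ i * (t *\<^sub>R \<alpha>) $ j * wt P i j \<le> (t * \<alpha> $ i) * (\<alpha> $ j)"
        by (simp add: mult_ac)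
    qed
    also have "\<dots> = (\<Sum>i\<in>I. t * \<alpha> $ i) * (\<Sum>j\<in>I. \<alpha> $ j)" by (simp add: sum_product)
    also have "\<dots> \<le> (\<Sum>i\<in>I. t * \<alpha> $ i) * 1"
    proof (intro mult_left_mono sum_nonneg)
      show "(\<Sum>j\<in>I. \<alpha> $ j) \<le> 1" unfolding \<alpha>(2)[symmetric] using \<alpha> by (intro sum_mono2) auto
      show "0 \<le> t * \<alpha> $ i" for i using \<alpha> t by simp
    qed
    finally have "(\<Sum>i\<in>I. \<Sum>j\<in>I. (t *\<^sub>R \<alpha>) $ i * (t *\<^sub>R \<alpha>) $ j * wt P i j) \<le> (\<Sum>i\<in>I. (t *\<^sub>R \<alpha>) $ i)"
      by simp
    moreover have "0 \<le> (\<Sum>i\<in>I. (t *\<^sub>R \<alpha>) $ i)" using \<alpha> t by (intro sum_nonneg) auto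
    ultimately show ?thesis unfolding g_eq by linarith
  qed
  then have "t *\<^sub>R \<alpha> \<in> admissible P" using \<alpha> t by (auto simp: admissible_def)
  then have "t *\<^sub>R \<alpha> \<in> convex hull (admissible P)" by (rule hull_inc)
  from cstar_ge[OF \<alpha> _ this] t show ?thesis by simp
qed

text \<open>The constraint for an index set \<open>I\<close> sees only the vertices of
  \<open>S\<close> in blocks from \<open>I\<close>. These form a subset \<open>T\<close>, and the
  constraint is the hypothesis for \<open>T\<close> times \<theta>. This is why the hypothesis
  ranges over all subsets.\<close>

lemma profile_admissible:
  assumes \<theta>: "0 < \<theta>" and S: "finite S"
    and good: "\<And>T. T \<subseteq> S \<Longrightarrow> T \<noteq> {} \<Longrightarrow> \<theta> / 2 * quad P (profile b T) \<le> real (card T)"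
  shows "\<theta> *\<^sub>R profile b S \<in> admissible P"
proof -
  have "0 \<le> g P (\<theta> *\<^sub>R profile b S) I" for I
  proof -
    define T where "T = {v \<in> S. b v \<in> I}"
    have T: "T \<subseteq> S" "finite T" using S by (auto simp: T_def)
    have p: "profile b T $ i = (if i \<in> I then profile b S $ i else 0)" for i
    proof -
      have "{v \<in> T. b v = i} = (if i \<in> I then {v \<in> S. b v = i} else {})" by (auto simp: T_def)
      then show ?thesis by (simp add: profile_def)
    qed
    have "(\<Sum>i\<in>I. profile b S $ i) = (\<Sum>i\<in>UNIV. profile b T $ i)"
      by (intro sum.mono_neutral_cong_left) (auto simp: p)
    then have 1: "(\<Sum>i\<in>I. profile b S $ i) = real (card T)" by (simp add: sum_profile[OF T(2)])
    have 2: "(\<Sum>i\<in>I. \<Sum>j\<in>I. profile b S $ i * profile b S $ j * wt P i j) = quad P (profile b T)"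
    proof -
      have "(\<Sum>j\<in>I. profile b S $ i * profile b S $ j * wt P i j) =
        (\<Sum>j\<in>UNIV. profile b T $ i * profile b T $ j * wt P i j)" if "i \<in> I" for i
        using that by (intro sum.mono_neutral_cong_left) (auto simp: p)
      then show ?thesis
        unfolding quad_def by (intro sum.mono_neutral_cong_left) (auto simp: p)
    qed
    have "g P (\<theta> *\<^sub>R profile b S) I = \<theta> * ((\<Sum>i\<in>I. profile b S $ i)
      - \<theta> / 2 * (\<Sum>i\<in>I. \<Sum>j\<in>I. profile b S $ i * profile b S $ j * wt P i j))"
      by (simp add: g_eq sum_distrib_left right_diff_distrib sum_divide_distrib mult_ac)
    also have "\<dots> = \<theta> * (real (card T) - \<theta> / 2 * quad P (profile b T))" by (simp only: 1 2)
    also have "0 \<le> \<dots>"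
      using good[OF T(1)] \<theta> by (cases "T = {}") (auto simp: quad_def profile_def)
    finally show ?thesis .
  qed
  then show ?thesis using \<theta> by (auto simp: admissible_def profile_def)
qed

text \<open>The scaled profiles of the colour classes are admissible, so their average over the
  \<open>q\<close> colours lies in the convex hull. The average equals \<theta> times the profile of
  \<open>V\<close> divided by \<open>q\<close>, hence dominates (t / q) \<alpha>. By downward
  closure t / q is at most \<open>cstar\<close>.\<close>

lemma colouring_lower_bound:
  assumes \<alpha>: "\<And>i. 0 \<le> \<alpha> $ i" "(\<Sum>i\<in>UNIV. \<alpha> $ i) = 1" and \<theta>: "0 < \<theta>"
    and V: "finite V" "V \<noteq> {}"
    and good: "\<And>S. S \<subseteq> V \<Longrightarrow> S \<noteq> {} \<Longrightarrow> indep_set E S \<Longrightarrow> \<theta> / 2 * quad P (profile b S) \<le> real (card S)"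
    and col: "proper_coloring V E q f"
    and t: "0 \<le> t" "\<And>i. t * \<alpha> $ i \<le> \<theta> * profile b V $ i"
  shows "t \<le> real q * cstar \<alpha> P"
proof -
  have f: "f ` V \<subseteq> {..<q}" using col by (simp add: proper_coloring_def)
  then have q: "0 < q" using V by fastforce
  define S where "S c = {v \<in> V. f v = c}" for c
  have ind: "indep_set E (S c)" for c
    unfolding indep_set_def
  proof (intro ballI impI notI)
    fix u v assume uv: "u \<in> S c" "v \<in> S c" "u \<noteq> v" "{u, v} \<in> E"
    then have "u \<in> V" "v \<in> V" "f u = f v" by (auto simp: S_def)
    moreover have "\<forall>u\<in>V. \<forall>v\<in>V. u \<noteq> v \<and> {u, v} \<in> E \<longrightarrow> f u \<noteq> f v"
      using col by (simp add: proper_coloring_def)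
    ultimately show False using uv by blast
  qed
  have adm: "\<theta> *\<^sub>R profile b (S c) \<in> admissible P" for c
  proof (rule profile_admissible[OF \<theta>])
    show "finite (S c)" using V by (simp add: S_def)
    fix T assume T: "T \<subseteq> S c" "T \<noteq> {}"
    then show "\<theta> / 2 * quad P (profile b T) \<le> real (card T)"
      by (intro good indep_set_subset[OF ind]) (auto simp: S_def)
  qed
  define y where "y = (\<Sum>c<q. (1 / real q) *\<^sub>R (\<theta> *\<^sub>R profile b (S c)))"
  have y: "y \<in> convex hull (admissible P)"
    unfolding y_def
    by (rule convex_sum) (use q adm in \<open>auto intro: hull_inc\<close>)
  have "(\<Sum>c<q. profile b (S c) $ i) = profile b V $ i" for i
  proof -
    have "(\<Sum>c<q. card {v \<in> S c. b v = i}) = (\<Sum>c<q. card {v \<in> {v \<in> V. b v = i}. f v = c})"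
      by (intro sum.cong arg_cong[where f = card]) (auto simp: S_def)
    also have "\<dots> = card {v \<in> V. b v = i}"
      using sum.group[of "{v \<in> V. b v = i}" "{..<q}" f "\<lambda>_. 1::nat"] V f by (simp add: image_subset_iff)
    finally show ?thesis unfolding profile_def by (simp flip: of_nat_sum)
  qed
  then have yi: "y $ i = \<theta> * profile b V $ i / real q" for i
    by (simp add: y_def sum_component sum_distrib_left[symmetric] sum_divide_distrib[symmetric])
  have "(t / real q) *\<^sub>R \<alpha> \<in> convex hull (admissible P)"
    by (rule convex_hull_admissible_mono[OF y]) (use t \<alpha> q in \<open>auto simp: yi divide_right_mono\<close>)
  from cstar_ge[OF \<alpha> _ this] t q show ?thesis by (simp add: field_simps)
qed

end

section \<open>Independent sets of prescribed profile\<close>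

definition profile_sets :: "(nat \<Rightarrow> 'k) \<Rightarrow> nat set \<Rightarrow> ('k \<Rightarrow> nat) \<Rightarrow> nat set set" where
  "profile_sets b W s = {S. S \<subseteq> W \<and> (\<forall>i. card {v \<in> S. b v = i} = s i)}"

text \<open>A uniformly random \<open>s\<close>-subset of a \<open>w\<close>-set contains a given
  \<open>l\<close>-set with probability at most (s / w)^l. The induction multiplies by the factors
  (s - l) / (w - l), each at most s / w (this is \<open>rw\<close>), in a form free of
  division.\<close>

lemma binomial_superset_le:
  assumes "l \<le> s" "s \<le> w"
  shows "((w - l) choose (s - l)) * w ^ l \<le> s ^ l * (w choose s)"
  using assms(1)
proof (induction l)
  case (Suc l)
  define u where "u = w - Suc l"
  define r where "r = s - Suc l"
  have ur: "w - l = Suc u" "s - l = Suc r" using Suc.prems assms(2) by (auto simp: u_def r_def)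
  have absorb: "(u choose r) * Suc u = Suc r * (Suc u choose Suc r)"
    using Suc_times_binomial[of r u] by (simp add: mult.commute)
  have IH: "(Suc u choose Suc r) * w ^ l \<le> s ^ l * (w choose s)"
    using Suc by (simp only: ur)
  have rw: "Suc r * w \<le> s * Suc u"
  proof -
    have "s = Suc r + l" "w = Suc u + l" using ur Suc.prems assms(2) by auto
    moreover have "Suc r \<le> Suc u" using assms(2) by (auto simp: r_def u_def)
    ultimately show ?thesis by (auto simp: algebra_simps)
  qed
  have "(u choose r) * w ^ Suc l * Suc u = (u choose r) * Suc u * (w * w ^ l)"
    by (simp only: power_Suc mult_ac)
  also have "\<dots> = Suc r * w * ((Suc u choose Suc r) * w ^ l)"
    unfolding absorb by (simp only: mult_ac)
  also have "\<dots> \<le> s * Suc u * (s ^ l * (w choose s))"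
    by (rule mult_le_mono[OF rw IH])
  also have "\<dots> = s ^ Suc l * (w choose s) * Suc u" by (simp only: power_Suc mult_ac)
  finally have "(u choose r) * w ^ Suc l \<le> s ^ Suc l * (w choose s)"
    by (simp only: mult_le_cancel2)
  then show ?case by (simp only: u_def r_def)
qed simp

lemma card_intermediate_sets_le:
  assumes W: "finite W" "T \<subseteq> W"
  shows "card {X. T \<subseteq> X \<and> X \<subseteq> W \<and> card X = s} * card W ^ card T \<le> s ^ card T * (card W choose s)"
proof (cases "card T \<le> s \<and> s \<le> card W")
  case True
  have T: "finite T" using W finite_subset by blast
  have "card {X. T \<subseteq> X \<and> X \<subseteq> W \<and> card X = s} \<le> card {Y. Y \<subseteq> W - T \<and> card Y = s - card T}"
  proof (rule card_inj_on_le)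
    show "inj_on (\<lambda>X. X - T) {X. T \<subseteq> X \<and> X \<subseteq> W \<and> card X = s}"
      by (rule inj_onI) blast
    show "(\<lambda>X. X - T) ` {X. T \<subseteq> X \<and> X \<subseteq> W \<and> card X = s} \<subseteq> {Y. Y \<subseteq> W - T \<and> card Y = s - card T}"
      using T by (auto simp: card_Diff_subset)
    show "finite {Y. Y \<subseteq> W - T \<and> card Y = s - card T}"
      using W by (auto intro: finite_subset[of _ "Pow (W - T)"])
  qed
  also have "\<dots> = (card W - card T) choose (s - card T)"
    using W T by (simp add: n_subsets card_Diff_subset)
  finally have "card {X. T \<subseteq> X \<and> X \<subseteq> W \<and> card X = s} * card W ^ card T \<le>
      ((card W - card T) choose (s - card T)) * card W ^ card T" by (rule mult_le_mono1)
  also have "\<dots> \<le> s ^ card T * (card W choose s)"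
    using True by (intro binomial_superset_le) auto
  finally show ?thesis .
next
  case False
  have "False" if "T \<subseteq> X" "X \<subseteq> W" "card X = s" for X
    using that False W card_mono[of W X] card_mono[of X T] finite_subset[of X W] by auto
  then have "{X. T \<subseteq> X \<and> X \<subseteq> W \<and> card X = s} = {}" by blast
  then show ?thesis by (simp only: card.empty)
qed

text \<open>A set is determined by its intersections with the blocks, and these can be chosen
  independently of each other.\<close>

lemma card_profile_sets_above:
  fixes b :: "nat \<Rightarrow> 'k::finite"
  assumes W: "finite W" "T \<subseteq> W"
  shows "card {S \<in> profile_sets b W s. T \<subseteq> S} =
    (\<Prod>i\<in>UNIV. card {X. {v \<in> T. b v = i} \<subseteq> X \<and> X \<subseteq> {v \<in> W. b v = i} \<and> card X = s i})"
proof -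
  let ?B = "\<lambda>i. {X. {v \<in> T. b v = i} \<subseteq> X \<and> X \<subseteq> {v \<in> W. b v = i} \<and> card X = s i}"
  have "bij_betw (\<lambda>S i. {v \<in> S. b v = i}) {S \<in> profile_sets b W s. T \<subseteq> S} (PiE UNIV ?B)"
  proof (rule bij_betw_byWitness[where f' = "\<lambda>F. \<Union>i. F i"])
    show "\<forall>S\<in>{S \<in> profile_sets b W s. T \<subseteq> S}. (\<Union>i. {v \<in> S. b v = i}) = S" by auto
    have F: "{v \<in> (\<Union>j. F j). b v = i} = F i" if "F \<in> PiE UNIV ?B" for F i
    proof -
      have "F j \<subseteq> {v \<in> W. b v = j}" for j using PiE_mem[OF that, of j] by simp
      then show ?thesis by blast
    qed
    then show "\<forall>F\<in>PiE UNIV ?B. (\<lambda>i. {v \<in> (\<Union>j. F j). b v = i}) = F" by (simp add: fun_eq_iff)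
    show "(\<lambda>S i. {v \<in> S. b v = i}) ` {S \<in> profile_sets b W s. T \<subseteq> S} \<subseteq> PiE UNIV ?B"
      by (auto simp: profile_sets_def)
    show "(\<lambda>F. \<Union>i. F i) ` PiE UNIV ?B \<subseteq> {S \<in> profile_sets b W s. T \<subseteq> S}"
    proof
      fix S assume "S \<in> (\<lambda>F. \<Union>i. F i) ` PiE UNIV ?B"
      then obtain F where FB: "F \<in> PiE UNIV ?B" and S: "S = (\<Union>i. F i)" by auto
      have Fi: "{v \<in> T. b v = i} \<subseteq> F i" "F i \<subseteq> {v \<in> W. b v = i}" "card (F i) = s i" for i
        using PiE_mem[OF FB, of i] by auto
      have "S \<subseteq> W" using Fi(2) S by blast
      moreover have "T \<subseteq> S" using Fi(1) S by blast
      ultimately show "S \<in> {S \<in> profile_sets b W s. T \<subseteq> S}"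
        using F[OF FB] Fi(3) by (simp add: profile_sets_def S)
    qed
  qed
  then have "card {S \<in> profile_sets b W s. T \<subseteq> S} = card (PiE UNIV ?B)" by (rule bij_betw_same_card)
  also have "\<dots> = (\<Prod>i\<in>UNIV. card (?B i))" by (rule card_PiE) simp
  finally show ?thesis .
qed

lemma card_profile_sets:
  fixes b :: "nat \<Rightarrow> 'k::finite"
  assumes "finite W" "\<And>i. card {v \<in> W. b v = i} = m"
  shows "card (profile_sets b W s) = (\<Prod>i\<in>UNIV. m choose s i)"
proof -
  have "card (profile_sets b W s) = (\<Prod>i\<in>UNIV. card {X. X \<subseteq> {v \<in> W. b v = i} \<and> card X = s i})"
    using card_profile_sets_above[OF assms(1), of "{}" b s] by simp
  also have "\<dots> = (\<Prod>i\<in>UNIV. m choose s i)"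
    using assms by (intro prod.cong refl) (simp add: n_subsets)
  finally show ?thesis .
qed

text \<open>In probabilistic terms: a random set of the prescribed profile contains \<open>T\<close>
  with probability at most (N / m)^|T|. The bound is the product of the corresponding bounds in each
  block.\<close>

lemma card_profile_sets_above_le:
  fixes b :: "nat \<Rightarrow> 'k::finite"
  assumes W: "finite W" "T \<subseteq> W" and m: "\<And>i. card {v \<in> W. b v = i} = m" and N: "\<And>i. s i \<le> N"
  shows "card {S \<in> profile_sets b W s. T \<subseteq> S} * m ^ card T \<le> N ^ card T * card (profile_sets b W s)"
proof -
  let ?T = "\<lambda>i. {v \<in> T. b v = i}"
  have T: "finite T" using W finite_subset by blast
  have pow: "(\<Prod>i\<in>UNIV. x ^ card (?T i)) = x ^ card T" for x :: nat
  proof -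
    have "(\<Prod>i\<in>UNIV. x ^ card (?T i)) = x ^ (\<Sum>i\<in>UNIV. card (?T i))" by (rule power_sum[symmetric])
    also have "(\<Sum>i\<in>UNIV. card (?T i)) = card T"
      using sum.group[of T UNIV b "\<lambda>_. 1::nat"] T by simp
    finally show ?thesis .
  qed
  have "card {S \<in> profile_sets b W s. T \<subseteq> S} * m ^ card T =
    (\<Prod>i\<in>UNIV. card {X. ?T i \<subseteq> X \<and> X \<subseteq> {v \<in> W. b v = i} \<and> card X = s i} * m ^ card (?T i))"
    by (simp add: card_profile_sets_above[OF W] prod.distrib pow)
  also have "\<dots> \<le> (\<Prod>i\<in>UNIV. s i ^ card (?T i) * (m choose s i))"
  proof (intro prod_mono conjI)
    fix i
    show "card {X. ?T i \<subseteq> X \<and> X \<subseteq> {v \<in> W. b v = i} \<and> card X = s i} * m ^ card (?T i)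
      \<le> s i ^ card (?T i) * (m choose s i)"
      using card_intermediate_sets_le[of "{v \<in> W. b v = i}" "?T i" "s i"] W m by auto
  qed simp
  also have "\<dots> \<le> (\<Prod>i\<in>UNIV. N ^ card (?T i) * (m choose s i))"
    by (intro prod_mono conjI mult_le_mono power_mono N) auto
  also have "\<dots> = N ^ card T * card (profile_sets b W s)"
    by (simp add: prod.distrib pow card_profile_sets[OF W(1) m])
  finally show ?thesis .
qed

section \<open>Janson's inequality for the family of all sets with a given profile\<close>

context block_model
begin

text \<open>Janson's inequality for the edge sets of the members of
  \<open>profile_sets b W s\<close>. All members are independent with the same probability
  \<open>q\<close>, so the expected number \<mu> of independent ones is \<open>card ?F * q\<close>.
  The correlation sum, grouped by overlaps, is at most \<mu>^2 R, and the exponent \<mu>^2 / (2 D)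
  becomes 1 / (2 R).\<close>

lemma prob_no_indep_profile_set:
  fixes b :: "nat \<Rightarrow> 'k"
  assumes W: "W \<subseteq> {..<n}" and m: "\<And>i. card {v \<in> W. b v = i} = m" "0 < m"
    and s: "\<And>i. s i \<le> N" "\<And>i. s i \<le> m"
    and R: "0 < R" "\<And>S. S \<in> profile_sets b W s \<Longrightarrow>
      (\<Sum>T\<in>{T \<in> Pow S. 2 \<le> card T}. (real N / real m) ^ card T / indep_prob b T) \<le> R"
  shows "measure_pmf.prob (random_block_graph n b P) {E. \<forall>S\<in>profile_sets b W s. \<not> indep_set E S}
    \<le> exp (- (1 / (2 * R)))"
proof -
  let ?F = "profile_sets b W s"
  let ?p = "\<lambda>e. P $ b (fst e) $ b (snd e)"
  have fW: "finite W" using W finite_subset by blast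
  have F: "S \<subseteq> W" "finite S" if "S \<in> ?F" for S
    using that fW by (auto simp: profile_sets_def intro: finite_subset)
  have finF: "finite ?F" by (rule finite_subset[of _ "Pow W"]) (use F fW in auto)
  \<comment> \<open>A nonempty family is needed both to define \<open>q\<close> and to make \<mu>
    positive.\<close>
  have "0 < card ?F" using s(2) by (auto simp: card_profile_sets[OF fW m(1)] intro!: prod_pos)
  then obtain S0 where S0: "S0 \<in> ?F" using card_gt_0_iff by fastforce
  define q where "q = indep_prob b S0"
  have q: "indep_prob b S = q" if "S \<in> ?F" for S
  proof -
    have "profile b S = profile b S0"
      using that S0 by (auto simp: profile_sets_def profile_def)
    then show ?thesis by (simp add: q_def indep_prob_eq F that S0)
  qed
  have q0: "0 < q" unfolding q_def by (rule indep_prob_pos[OF F(2)[OF S0]])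
  define \<mu> where "\<mu> = real (card ?F) * q"
  have \<mu>: "0 < \<mu>" using q0 \<open>0 < card ?F\<close> by (simp add: \<mu>_def)
  have "(\<Sum>S\<in>?F. \<Sum>S'\<in>{S' \<in> ?F. edge_pairs S \<inter> edge_pairs S' \<noteq> {}}. \<Prod>e\<in>edge_pairs S \<union> edge_pairs S'. 1 - ?p e)
    \<le> (\<Sum>S\<in>?F. q\<^sup>2 * real (card ?F) * R)"
  proof (rule sum_mono)
    fix S assume S: "S \<in> ?F"
    let ?Q = "{T \<in> Pow S. 2 \<le> card T}"
    have finQ: "finite ?Q" using F(2)[OF S] by simp
    \<comment> \<open>The overlap S \<inter> S' is one of the sets \<open>T\<close> below
      \<open>S'\<close>; also counting every other such \<open>T\<close> costs only nonnegative
      terms and lets the two sums be exchanged. Since the edge sets share a pair, the overlap has at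
      least two vertices.\<close>
    have "(\<Sum>S'\<in>{S' \<in> ?F. edge_pairs S \<inter> edge_pairs S' \<noteq> {}}. \<Prod>e\<in>edge_pairs S \<union> edge_pairs S'. 1 - ?p e)
      \<le> (\<Sum>S'\<in>{S' \<in> ?F. edge_pairs S \<inter> edge_pairs S' \<noteq> {}}. \<Sum>T\<in>?Q. of_bool (T \<subseteq> S') * (q\<^sup>2 / indep_prob b T))"
    proof (rule sum_mono)
      fix S' assume "S' \<in> {S' \<in> ?F. edge_pairs S \<inter> edge_pairs S' \<noteq> {}}"
      then have S': "S' \<in> ?F" and ne: "edge_pairs (S \<inter> S') \<noteq> {}" by (auto simp: edge_pairs_Int)
      let ?T = "S \<inter> S'"
      from ne obtain u v where "u \<in> ?T" "v \<in> ?T" "u \<noteq> v" by (auto simp: edge_pairs_def)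
      then have "card {u, v} \<le> card ?T" by (intro card_mono) (use F(2)[OF S] in auto)
      then have T: "?T \<in> ?Q" using \<open>u \<noteq> v\<close> by simp
      \<comment> \<open>The common pairs of \<open>S\<close> and \<open>S'\<close> are exactly the
        pairs inside the overlap, so dividing by its probability removes the double count.\<close>
      have "(\<Prod>e\<in>edge_pairs S \<union> edge_pairs S'. 1 - ?p e) * indep_prob b ?T = indep_prob b S * indep_prob b S'"
        unfolding indep_prob_def edge_pairs_Int[symmetric]
        by (rule prod.union_inter) (use F S S' in auto)
      then have "(\<Prod>e\<in>edge_pairs S \<union> edge_pairs S'. 1 - ?p e) = q\<^sup>2 / indep_prob b ?T"
        using indep_prob_pos[of ?T b] F(2)[OF S] by (simp add: q S S' field_simps power2_eq_square)
      also have "\<dots> = of_bool (?T \<subseteq> S') * (q\<^sup>2 / indep_prob b ?T)" by simp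
      also have "\<dots> \<le> (\<Sum>T\<in>?Q. of_bool (T \<subseteq> S') * (q\<^sup>2 / indep_prob b T))"
      proof (rule member_le_sum[OF T])
        fix T assume "T \<in> ?Q - {?T}"
        then have "finite T" using F(2)[OF S] by (auto intro: finite_subset)
        then show "0 \<le> of_bool (T \<subseteq> S') * (q\<^sup>2 / indep_prob b T)"
          using indep_prob_pos[of T b] by simp
      qed (use finQ in auto)
      finally show "(\<Prod>e\<in>edge_pairs S \<union> edge_pairs S'. 1 - ?p e) \<le> (\<Sum>T\<in>?Q. of_bool (T \<subseteq> S') * (q\<^sup>2 / indep_prob b T))" .
    qed
    also have "\<dots> \<le> (\<Sum>S'\<in>?F. \<Sum>T\<in>?Q. of_bool (T \<subseteq> S') * (q\<^sup>2 / indep_prob b T))"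
    proof (intro sum_mono2 finF sum_nonneg)
      fix T assume "T \<in> ?Q"
      then have "finite T" using F(2)[OF S] by (auto intro: finite_subset)
      then show "0 \<le> of_bool (T \<subseteq> S') * (q\<^sup>2 / indep_prob b T)" for S'
        using indep_prob_pos[of T b] by simp
    qed auto
    also have "\<dots> = (\<Sum>T\<in>?Q. real (card {S' \<in> ?F. T \<subseteq> S'}) * (q\<^sup>2 / indep_prob b T))"
      unfolding sum.swap[of _ ?Q ?F] sum_distrib_right[symmetric]
      using finF by (intro sum.cong refl) (simp add: sum_of_bool_eq Int_def)
    also have "\<dots> \<le> (\<Sum>T\<in>?Q. q\<^sup>2 * real (card ?F) * ((real N / real m) ^ card T / indep_prob b T))"
    proof (rule sum_mono)
      fix T assume T: "T \<in> ?Q"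
      then have Tf: "finite T" and TW: "T \<subseteq> W" using F[OF S] by (auto intro: finite_subset)
      have "real (card {S' \<in> ?F. T \<subseteq> S'} * m ^ card T) \<le> real (N ^ card T * card ?F)"
        by (intro of_nat_mono card_profile_sets_above_le fW TW m s)
      then have "real (card {S' \<in> ?F. T \<subseteq> S'}) \<le> (real N / real m) ^ card T * real (card ?F)"
        using m(2) by (simp add: field_simps)
      then have "real (card {S' \<in> ?F. T \<subseteq> S'}) * (q\<^sup>2 / indep_prob b T) \<le>
          (real N / real m) ^ card T * real (card ?F) * (q\<^sup>2 / indep_prob b T)"
        using indep_prob_pos[OF Tf, of b] by (intro mult_right_mono) auto
      then show "real (card {S' \<in> ?F. T \<subseteq> S'}) * (q\<^sup>2 / indep_prob b T) \<le>
          q\<^sup>2 * real (card ?F) * ((real N / real m) ^ card T / indep_prob b T)"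
        by (simp add: mult_ac)
    qed
    also have "\<dots> \<le> q\<^sup>2 * real (card ?F) * R"
      unfolding sum_distrib_left[symmetric] by (intro mult_left_mono R(2) S) auto
    finally show "(\<Sum>S'\<in>{S' \<in> ?F. edge_pairs S \<inter> edge_pairs S' \<noteq> {}}. \<Prod>e\<in>edge_pairs S \<union> edge_pairs S'. 1 - ?p e)
      \<le> q\<^sup>2 * real (card ?F) * R" .
  qed
  also have "\<dots> = \<mu>\<^sup>2 * R" by (simp add: \<mu>_def power2_eq_square)
  finally have D: "(\<Sum>S\<in>?F. \<Sum>S'\<in>{S' \<in> ?F. edge_pairs S \<inter> edge_pairs S' \<noteq> {}}. \<Prod>e\<in>edge_pairs S \<union> edge_pairs S'. 1 - ?p e)
    \<le> \<mu>\<^sup>2 * R" .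
  have "measure_pmf.prob (random_block_graph n b P) {E. \<forall>S\<in>?F. \<not> indep_set E S} =
    subset_sum (edge_pairs {..<n}) ?p (\<lambda>e. 1 - ?p e) (\<lambda>T. of_bool (\<forall>S\<in>?F. T \<inter> edge_pairs S \<noteq> {}))"
    unfolding prob_random_block_graph
    by (intro subset_sum_cong arg_cong[where f = of_bool] ball_cong refl) (simp add: indep_set_graph_of)
  also have "\<dots> \<le> exp (- (\<mu>\<^sup>2 / (2 * (\<mu>\<^sup>2 * R))))"
  proof (rule janson_subset_sum[OF _ finF])
    show "\<mu> = (\<Sum>S\<in>?F. \<Prod>e\<in>edge_pairs S. 1 - ?p e)"
      by (simp add: \<mu>_def indep_prob_def[symmetric] q)
    show "edge_pairs S \<subseteq> edge_pairs {..<n}" if "S \<in> ?F" for S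
      using F(1)[OF that] W by (intro edge_pairs_mono) auto
    show "0 \<le> ?p e" "0 < 1 - ?p e" for e using P[of "b (fst e)" "b (snd e)"] by auto
  qed (use D \<mu> R in auto)
  also have "\<mu>\<^sup>2 / (2 * (\<mu>\<^sup>2 * R)) = 1 / (2 * R)" using \<mu> R by (simp add: field_simps)
  finally show ?thesis .
qed

end

text \<open>Each entry of \<open>ss\<close> is the profile of one colour class. The capacity
  condition leaves at least \<open>m\<close> vertices in every block while classes are being
  extracted, so an independent set of the next profile always exists. Vertices left at the end get
  one colour each, which accounts for the second summand.\<close>

lemma greedy_colouring:
  fixes b :: "nat \<Rightarrow> 'k::finite"
  assumes "finite V"
    and "\<And>s W. s \<in> set ss \<Longrightarrow> W \<subseteq> V \<Longrightarrow> (\<And>i. m \<le> card {v \<in> W. b v = i}) \<Longrightarrow>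
      \<exists>S\<in>profile_sets b W s. indep_set E S"
    and "\<And>i. (\<Sum>s\<leftarrow>ss. s i) + m \<le> card {v \<in> V. b v = i}"
  shows "\<exists>f. proper_coloring V E (length ss + (card V - (\<Sum>s\<leftarrow>ss. \<Sum>i\<in>UNIV. s i))) f"
  using assms
proof (induction ss arbitrary: V)
  case Nil
  then obtain f where "bij_betw f V {..<card V}"
    using ex_bij_betw_finite_nat[of V] by (auto simp: atLeast0LessThan)
  then have "proper_coloring V E (card V) f"
    by (auto simp: proper_coloring_def bij_betw_def inj_on_def)
  then show ?case by auto
next
  case (Cons s ss)
  have cap: "s i + (\<Sum>s\<leftarrow>ss. s i) + m \<le> card {v \<in> V. b v = i}" for i
    using Cons.prems(3)[of i] by simp
  have "m \<le> card {v \<in> V. b v = i}" for i using cap[of i] by simp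
  then obtain S where S: "S \<in> profile_sets b V s" "indep_set E S"
    using Cons.prems(2)[of s V] by auto
  have SV: "S \<subseteq> V" and Si: "card {v \<in> S. b v = i} = s i" for i
    using S by (auto simp: profile_sets_def)
  have fS: "finite S" using SV Cons.prems(1) finite_subset by blast
  have cS: "card S = (\<Sum>i\<in>UNIV. s i)"
    using sum.group[of S UNIV b "\<lambda>_. 1::nat"] fS by (simp add: Si)
  let ?V = "V - S"
  have cV: "card {v \<in> ?V. b v = i} = card {v \<in> V. b v = i} - s i" for i
  proof -
    have "{v \<in> ?V. b v = i} = {v \<in> V. b v = i} - {v \<in> S. b v = i}" by auto
    then show ?thesis using SV fS by (simp add: Si[symmetric] card_Diff_subset Collect_mono_iff subset_iff)
  qed
  define q where "q = length ss + (card ?V - (\<Sum>s\<leftarrow>ss. \<Sum>i\<in>UNIV. s i))"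
  have "\<exists>f. proper_coloring ?V E q f"
    unfolding q_def
  proof (rule Cons.IH)
    show "\<exists>S\<in>profile_sets b W s'. indep_set E S"
      if "s' \<in> set ss" "W \<subseteq> ?V" "\<And>i. m \<le> card {v \<in> W. b v = i}" for s' W
      using Cons.prems(2)[of s' W] that by auto
    show "(\<Sum>s\<leftarrow>ss. s i) + m \<le> card {v \<in> ?V. b v = i}" for i
      unfolding cV using cap[of i] by linarith
  qed (use Cons.prems in auto)
  then obtain f where f: "f ` ?V \<subseteq> {..<q}" "\<And>u v. u \<in> ?V \<Longrightarrow> v \<in> ?V \<Longrightarrow> u \<noteq> v \<Longrightarrow> {u, v} \<in> E \<Longrightarrow> f u \<noteq> f v"
    by (auto simp: proper_coloring_def)
  \<comment> \<open>The extracted set takes the new colour \<open>q\<close>; the colouring of the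
    remainder uses only colours below \<open>q\<close>.\<close>
  define h where "h v = (if v \<in> S then q else f v)" for v
  have "proper_coloring V E (Suc q) h"
    unfolding proper_coloring_def
  proof (intro conjI ballI impI)
    show "h ` V \<subseteq> {..<Suc q}" using f(1) by (auto simp: h_def less_Suc_eq)
    fix u v assume uv: "u \<in> V" "v \<in> V" "u \<noteq> v \<and> {u, v} \<in> E"
    have lt: "f w < q" if "w \<in> V" "w \<notin> S" for w using f(1) that by auto
    consider "u \<in> S" "v \<in> S" | "u \<in> S" "v \<notin> S" | "u \<notin> S" "v \<in> S" | "u \<notin> S" "v \<notin> S" by blast
    then show "h u \<noteq> h v"
    proof cases
      case 1
      then show ?thesis using S(2) uv unfolding indep_set_def by blast
    next
      case 2
      then show ?thesis using lt[of v] uv by (simp add: h_def)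
    next
      case 3
      then show ?thesis using lt[of u] uv by (simp add: h_def)
    next
      case 4
      then show ?thesis using f(2)[of u v] uv by (simp add: h_def)
    qed
  qed
  moreover have "Suc q = length (s # ss) + (card V - (\<Sum>s\<leftarrow>s # ss. \<Sum>i\<in>UNIV. s i))"
    using SV fS by (simp add: q_def card_Diff_subset cS)
  ultimately show ?case by metis
qed

lemma exists_list_with_multiplicities:
  fixes s :: "'j \<Rightarrow> 'i \<Rightarrow> nat"
  assumes "finite J"
  shows "\<exists>ss. set ss \<subseteq> s ` J \<and> length ss = (\<Sum>j\<in>J. r j) \<and> (\<forall>i. (\<Sum>x\<leftarrow>ss. x i) = (\<Sum>j\<in>J. r j * s j i))"
  using assms
proof (induction J)
  case (insert j J)
  then obtain ss where "set ss \<subseteq> s ` J" "length ss = (\<Sum>j\<in>J. r j)"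
    "\<forall>i. (\<Sum>x\<leftarrow>ss. x i) = (\<Sum>j\<in>J. r j * s j i)" by blast
  then show ?case
    using insert.hyps
    by (intro exI[of _ "replicate (r j) (s j) @ ss"]) (auto simp: sum_list_replicate)
qed auto

text \<open>The number of vertices per block at which the extraction stops. It is o(n / ln n), so
  private colours for a reserve are affordable, and still n^(1 - o(1)), large enough for the Janson
  estimate.\<close>

definition reserve :: "nat \<Rightarrow> nat" where
  "reserve n = nat \<lceil>real n / (ln (real n))\<^sup>2\<rceil>"

text \<open>Rounding down keeps the profile below (1 - \<epsilon>) ln n times an admissible vector;
  the loss \<epsilon> is the slack that controls large overlaps.\<close>

definition target :: "real \<Rightarrow> real ^ 'k \<Rightarrow> nat \<Rightarrow> 'k \<Rightarrow> nat" where
  "target \<epsilon> a n i = nat \<lfloor>(1 - \<epsilon>) * a $ i * ln (real n)\<rfloor>"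

section \<open>Overlap estimates and the union bound over reserve sets\<close>

context block_model
begin

text \<open>Divided by \<open>l\<close>, the profile lies below \<open>a\<close> and is therefore
  admissible. Its constraint for the full index set, multiplied by l^2, is the claim. Thus the
  exponent of 1 / \<open>indep_prob\<close> grows at most linearly in the overlap.\<close>

lemma quad_profile_le_linear:
  assumes a: "a \<in> admissible P" and l: "0 < l" and T: "finite T" "\<And>i. profile b T $ i \<le> l * a $ i"
  shows "quad P (profile b T) / 2 \<le> l * real (card T)"
proof -
  define d where "d = (1 / l) *\<^sub>R profile b T"
  have "d \<in> admissible P"
    using l T(2) by (intro admissible_mono[OF a]) (auto simp: d_def profile_def field_simps)
  then have "0 \<le> g P d UNIV" by (auto simp: admissible_def)
  also have "g P d UNIV = real (card T) / l - quad P (profile b T) / l\<^sup>2 / 2"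
  proof -
    have "(\<Sum>i\<in>UNIV. d $ i) = real (card T) / l"
      by (simp add: d_def sum_divide_distrib[symmetric] sum_profile[OF T(1)])
    moreover have "quad P d = quad P (profile b T) / l\<^sup>2"
      by (simp add: d_def quad_def sum_divide_distrib power2_eq_square mult_ac)
    ultimately show ?thesis by (simp add: g_UNIV)
  qed
  finally have "0 \<le> l\<^sup>2 * (real (card T) / l - quad P (profile b T) / l\<^sup>2 / 2)" using l by simp
  then show ?thesis using l by (simp add: field_simps power2_eq_square)
qed

text \<open>Here \<open>t\<close> is the size of an overlap and \<open>X\<close> stands for ln n.
  For t \<le> 4 / \<epsilon> the quadratic bound gives Q \<le> 8 C / \<epsilon>^2 \<le> 0.3 X, while
  the subtracted term is at least 1.8 X. For larger \<open>t\<close> the linear bound leaves a gain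
  of at least t (\<epsilon> - \<eta>) X \<ge> t \<epsilon> X / 2 \<ge> 2 X.\<close>

lemma overlap_exponent_le:
  fixes t X Q :: real
  assumes \<epsilon>: "0 < \<epsilon>" and \<eta>: "\<eta> \<le> 1 / 10" "\<eta> \<le> \<epsilon> / 2" and t: "2 \<le> t" and X: "8 * C / \<epsilon>\<^sup>2 \<le> 3 / 10 * X"
    and Q: "Q \<le> C * t\<^sup>2 / 2" "Q \<le> (1 - \<epsilon>) * X * t"
  shows "Q - t * ((1 - \<eta>) * X) \<le> - (3 / 2 * X)"
proof -
  have "0 \<le> 8 * C / \<epsilon>\<^sup>2" using C_pos by simp
  then have X0: "0 \<le> X" using X by linarith
  show ?thesis
  proof (cases "t \<le> 4 / \<epsilon>")
    case True
    have "t\<^sup>2 \<le> (4 / \<epsilon>)\<^sup>2" using True t by (intro power_mono) auto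
    then have "C * t\<^sup>2 \<le> C * (16 / \<epsilon>\<^sup>2)"
      using C_pos by (intro mult_left_mono) (auto simp: power_divide)
    then have "Q \<le> 3 / 10 * X" using Q(1) X by simp
    moreover have "2 * ((9 / 10) * X) \<le> t * ((1 - \<eta>) * X)"
      using t \<eta> X0 by (intro mult_mono mult_right_mono) auto
    ultimately show ?thesis by simp
  next
    case False
    then have "4 \<le> t * \<epsilon>" using \<epsilon> by (simp add: field_simps)
    then have "4 * X \<le> t * \<epsilon> * X" using X0 by (rule mult_right_mono)
    moreover have "t * X * \<eta> \<le> t * X * (\<epsilon> / 2)" using t X0 \<eta> by (intro mult_left_mono) auto
    ultimately show ?thesis using Q(2) X0 by (simp add: algebra_simps)
  qed
qed

text \<open>Writing N / m as (N^2 / m) (1 / N) sets aside a factor 1 / N per vertex of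
  \<open>T\<close>; the rest is at most exp (- 3 X / 2) by \<open>overlap_exponent_le\<close>. The
  reserved factors sum over all subsets of \<open>S\<close> to at most (1 + 1 / N)^N \<le> e \<le>
  3.\<close>

lemma overlap_sum_le:
  fixes b :: "nat \<Rightarrow> 'k"
  assumes a: "a \<in> admissible P" and \<epsilon>: "0 < \<epsilon>" "\<epsilon> < 1" and \<eta>: "\<eta> \<le> 1 / 10" "\<eta> \<le> \<epsilon> / 2"
    and X: "8 * C / \<epsilon>\<^sup>2 \<le> 3 / 10 * X" "0 < X"
    and S: "finite S" "card S \<le> N" "\<And>i. profile b S $ i \<le> (1 - \<epsilon>) * X * a $ i"
    and N: "0 < N" "0 < m" "(real N)\<^sup>2 / real m \<le> exp (- ((1 - \<eta>) * X))"
  shows "(\<Sum>T\<in>{T \<in> Pow S. 2 \<le> card T}. (real N / real m) ^ card T / indep_prob b T) \<le> 3 * exp (- (3 / 2 * X))"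
proof -
  let ?\<rho> = "exp (- (3 / 2 * X))"
  have "(\<Sum>T\<in>{T \<in> Pow S. 2 \<le> card T}. (real N / real m) ^ card T / indep_prob b T)
    \<le> (\<Sum>T\<in>{T \<in> Pow S. 2 \<le> card T}. ?\<rho> * (1 / real N) ^ card T)"
  proof (rule sum_mono)
    fix T assume "T \<in> {T \<in> Pow S. 2 \<le> card T}"
    then have T: "T \<subseteq> S" "2 \<le> card T" "finite T" using S(1) by (auto intro: finite_subset)
    define Q where "Q = quad P (profile b T) / 2"
    have "profile b T $ i \<le> (1 - \<epsilon>) * X * a $ i" for i
    proof -
      have "profile b T $ i \<le> profile b S $ i"
        using T S(1) by (auto simp: profile_def intro!: card_mono)
      then show ?thesis using S(3)[of i] by linarith
    qed
    then have "Q \<le> (1 - \<epsilon>) * X * card T"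
      unfolding Q_def using \<epsilon> X by (intro quad_profile_le_linear[OF a] T) auto
    moreover have "Q \<le> C * (real (card T))\<^sup>2 / 2"
      unfolding Q_def using quad_profile_le[OF T(3), of b] by simp
    ultimately have e: "Q - card T * ((1 - \<eta>) * X) \<le> - (3 / 2 * X)"
      using T(2) by (intro overlap_exponent_le[OF \<epsilon>(1) \<eta> _ X(1)]) auto
    have "real N / real m = ((real N)\<^sup>2 / real m) * (1 / real N)"
      using N by (simp add: power2_eq_square)
    then have "(real N / real m) ^ card T = ((real N)\<^sup>2 / real m) ^ card T * (1 / real N) ^ card T"
      by (simp only: power_mult_distrib)
    also have "\<dots> \<le> exp (- ((1 - \<eta>) * X)) ^ card T * (1 / real N) ^ card T"
      using N by (intro mult_right_mono power_mono) auto
    also have "exp (- ((1 - \<eta>) * X)) ^ card T = exp (- (card T * ((1 - \<eta>) * X)))"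
      by (simp add: exp_of_nat_mult[symmetric])
    finally have "(real N / real m) ^ card T / indep_prob b T
      \<le> (exp (- (card T * ((1 - \<eta>) * X))) * (1 / real N) ^ card T) / exp (- Q)"
      using indep_prob_lower[OF T(3), of b] by (intro frac_le) (auto simp: Q_def)
    also have "\<dots> = exp (Q - card T * ((1 - \<eta>) * X)) * (1 / real N) ^ card T"
      by (simp add: exp_diff exp_minus exp_add field_simps)
    also have "\<dots> \<le> ?\<rho> * (1 / real N) ^ card T"
      using e by (intro mult_right_mono) auto
    finally show "(real N / real m) ^ card T / indep_prob b T \<le> ?\<rho> * (1 / real N) ^ card T" .
  qed
  also have "\<dots> \<le> (\<Sum>T\<in>Pow S. ?\<rho> * (1 / real N) ^ card T)"
    using S(1) by (intro sum_mono2) auto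
  also have "\<dots> = ?\<rho> * (1 + 1 / real N) ^ card S"
    using sum_Pow_power_card[OF S(1), of "1 / real N"] by (simp add: sum_distrib_left[symmetric])
  also have "(1 + 1 / real N) ^ card S \<le> 3"
  proof -
    have "(1 + 1 / real N) ^ card S \<le> (1 + 1 / real N) ^ N"
      using S(2) by (intro power_increasing) auto
    also have "\<dots> \<le> exp (1 / real N) ^ N"
      by (intro power_mono exp_ge_add_one_self) auto
    also have "\<dots> = exp 1" using N by (simp add: exp_of_nat_mult[symmetric])
    also have "\<dots> \<le> 3" by (rule exp_le)
    finally show ?thesis .
  qed
  finally show ?thesis by (simp add: mult.commute)
qed

text \<open>With N of order ln n and m = \<open>reserve n\<close>, the ratio N^2 / m is n^(-1) up to
  powers of ln n, which n^\<eta> absorbs. The overlap sum is then at most R = 3 n^(- 3 / 2), and 1 /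
  (2 R) is the stated exponent.\<close>

lemma eventually_prob_no_target_set:
  assumes a: "a \<in> admissible P" and \<epsilon>: "0 < \<epsilon>" "\<epsilon> < 1"
  shows "\<forall>\<^sub>F n in sequentially. \<forall>(b :: nat \<Rightarrow> 'k) W. W \<subseteq> {..<n} \<longrightarrow>
    (\<forall>i. card {v \<in> W. b v = i} = reserve n) \<longrightarrow>
    measure_pmf.prob (random_block_graph n b P) {E. \<forall>S\<in>profile_sets b W (target \<epsilon> a n). \<not> indep_set E S}
      \<le> exp (- (real n powr (3 / 2) / 6))"
proof -
  \<comment> \<open>The added 1 keeps \<open>B\<close> positive even when
    \<open>a = 0\<close>.\<close>
  define B where "B = (\<Sum>i\<in>UNIV. a $ i) + 1"
  have a0: "0 \<le> a $ i" for i using a by (auto simp: admissible_def)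
  have "0 \<le> (\<Sum>i\<in>UNIV. a $ i)" by (intro sum_nonneg a0)
  then have B0: "0 < B" by (simp add: B_def)
  define \<eta> where "\<eta> = min (1 / 10) (\<epsilon> / 2)"
  have \<eta>: "0 < \<eta>" "\<eta> \<le> 1 / 10" "\<eta> \<le> \<epsilon> / 2" using \<epsilon> by (auto simp: \<eta>_def)
  have "\<forall>\<^sub>F n in sequentially. 8 * C / \<epsilon>\<^sup>2 \<le> 3 / 10 * ln (real n)" by real_asymp
  moreover have "\<forall>\<^sub>F n in sequentially. 1 < ln (real n)" by real_asymp
  moreover have "\<forall>\<^sub>F n in sequentially. (B * ln (real n) + 2)\<^sup>2 * (ln (real n))\<^sup>2 \<le> real n powr \<eta>"
    using B0 \<eta>(1) by real_asymp
  moreover have "\<forall>\<^sub>F n in sequentially. B * ln (real n) + 2 \<le> real n / (ln (real n))\<^sup>2"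
    using B0 by real_asymp
  ultimately show ?thesis
  proof eventually_elim
    case (elim n)
    define X where "X = ln (real n)"
    have X: "1 < X" "8 * C / \<epsilon>\<^sup>2 \<le> 3 / 10 * X" using elim by (auto simp: X_def)
    have n: "0 < real n" using X by (cases "n = 0") (auto simp: X_def)
    have n_exp: "real n powr x = exp (x * X)" for x using n by (simp add: powr_def X_def)
    define N where "N = nat \<lceil>B * X\<rceil> + 1"
    have "0 \<le> B * X" using B0 X by simp
    then have N: "B * X \<le> real N" "real N \<le> B * X + 2" "0 < N"
      unfolding N_def by linarith+
    define m where "m = reserve n"
    have m_ge: "real n / X\<^sup>2 \<le> real m"
      unfolding m_def reserve_def X_def by linarith
    have Nm: "real N \<le> real m" using N m_ge elim by (simp add: X_def)
    have m0: "0 < m" using Nm N by linarith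
    have ratio: "(real N)\<^sup>2 / real m \<le> exp (- ((1 - \<eta>) * X))"
    proof -
      have "(real N)\<^sup>2 / real m \<le> (B * X + 2)\<^sup>2 / (real n / X\<^sup>2)"
        using N m_ge n X by (intro frac_le power_mono) auto
      also have "\<dots> = (B * X + 2)\<^sup>2 * X\<^sup>2 / real n" by simp
      also have "\<dots> \<le> real n powr \<eta> / real n powr 1"
        using elim n by (intro frac_le) (auto simp: X_def)
      also have "\<dots> = exp (- ((1 - \<eta>) * X))"
        unfolding n_exp by (simp add: exp_diff[symmetric] algebra_simps)
      finally show ?thesis .
    qed
    let ?s = "target \<epsilon> a n"
    have s: "real (?s i) \<le> (1 - \<epsilon>) * X * a $ i" for i
    proof -
      have "0 \<le> (1 - \<epsilon>) * a $ i * ln (real n)" using \<epsilon> a0[of i] X by (auto simp: X_def)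
      then have "real (?s i) \<le> (1 - \<epsilon>) * a $ i * ln (real n)" unfolding target_def by linarith
      then show ?thesis by (simp add: X_def mult_ac)
    qed
    have "(\<Sum>i\<in>UNIV. real (?s i)) \<le> (\<Sum>i\<in>UNIV. X * a $ i)"
    proof (rule sum_mono)
      fix i
      have "(1 - \<epsilon>) * X * a $ i \<le> 1 * X * a $ i"
        using \<epsilon> X a0[of i] by (intro mult_right_mono) auto
      then show "real (?s i) \<le> X * a $ i" using s[of i] by simp
    qed
    also have "\<dots> \<le> B * X" using X by (simp add: B_def sum_distrib_left[symmetric] algebra_simps)
    finally have "real (\<Sum>i\<in>UNIV. ?s i) \<le> real N" using N(1) by simp
    then have sN: "(\<Sum>i\<in>UNIV. ?s i) \<le> N" by linarith
    have siN: "?s i \<le> N" for i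
      using member_le_sum[of i UNIV ?s] sN by simp
    show ?case
    proof (intro allI impI)
      fix b :: "nat \<Rightarrow> 'k" and W assume W: "W \<subseteq> {..<n}" and cW: "\<forall>i. card {v \<in> W. b v = i} = reserve n"
      have "measure_pmf.prob (random_block_graph n b P) {E. \<forall>S\<in>profile_sets b W ?s. \<not> indep_set E S}
        \<le> exp (- (1 / (2 * (3 * exp (- (3 / 2 * X))))))"
      proof (rule prob_no_indep_profile_set[OF W])
        show "card {v \<in> W. b v = i} = m" for i using cW by (simp add: m_def)
        show "0 < m" by (rule m0)
        show "?s i \<le> N" for i by (rule siN)
        show "?s i \<le> m" for i using siN[of i] Nm by linarith
        fix S assume S: "S \<in> profile_sets b W ?s"
        then have fS: "finite S" and Si: "card {v \<in> S. b v = i} = ?s i" for i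
          using W by (auto simp: profile_sets_def intro: finite_subset)
        have "card S = (\<Sum>i\<in>UNIV. ?s i)"
          using sum.group[of S UNIV b "\<lambda>_. 1::nat"] fS by (simp add: Si)
        then have "card S \<le> N" using sN by simp
        then show "(\<Sum>T\<in>{T \<in> Pow S. 2 \<le> card T}. (real N / real m) ^ card T / indep_prob b T) \<le> 3 * exp (- (3 / 2 * X))"
          using X N m0 ratio s Si
          by (intro overlap_sum_le[OF a \<epsilon> \<eta>(2,3) X(2)] fS) (auto simp: profile_def)
      qed simp
      also have "1 / (2 * (3 * exp (- (3 / 2 * X)))) = real n powr (3 / 2) / 6"
        unfolding n_exp by (simp add: exp_minus field_simps)
      finally show "measure_pmf.prob (random_block_graph n b P) {E. \<forall>S\<in>profile_sets b W ?s. \<not> indep_set E S}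
        \<le> exp (- (real n powr (3 / 2) / 6))" .
    qed
  qed
qed

text \<open>Union bound over at most 2^n sets \<open>W\<close>. It succeeds because the exponent
  n^(3/2) / 6 grows faster than n.\<close>

lemma prob_some_subset_no_target_set:
  fixes b :: "nat \<Rightarrow> nat \<Rightarrow> 'k"
  assumes a: "a \<in> admissible P" and \<epsilon>: "0 < \<epsilon>" "\<epsilon> < 1"
  shows "(\<lambda>n. measure_pmf.prob (random_block_graph n (b n) P)
     {E. \<exists>W\<subseteq>{..<n}. (\<forall>i. card {v \<in> W. b n v = i} = reserve n) \<and>
        (\<forall>S\<in>profile_sets (b n) W (target \<epsilon> a n). \<not> indep_set E S)}) \<longlonglongrightarrow> 0"
proof (rule tendsto_sandwich[where f = "\<lambda>_. 0" and h = "\<lambda>n. 2 ^ n * exp (- (real n powr (3 / 2) / 6))"])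
  show "\<forall>\<^sub>F n in sequentially. measure_pmf.prob (random_block_graph n (b n) P)
     {E. \<exists>W\<subseteq>{..<n}. (\<forall>i. card {v \<in> W. b n v = i} = reserve n) \<and>
        (\<forall>S\<in>profile_sets (b n) W (target \<epsilon> a n). \<not> indep_set E S)} \<le> 2 ^ n * exp (- (real n powr (3 / 2) / 6))"
    using eventually_prob_no_target_set[OF a \<epsilon>]
  proof eventually_elim
    case (elim n)
    let ?p = "measure_pmf.prob (random_block_graph n (b n) P)"
    define \<W> where "\<W> = {W \<in> Pow {..<n}. \<forall>i. card {v \<in> W. b n v = i} = reserve n}"
    let ?B = "\<lambda>W. {E. \<forall>S\<in>profile_sets (b n) W (target \<epsilon> a n). \<not> indep_set E S}"
    have fin: "finite \<W>" by (simp add: \<W>_def)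
    have "?p {E. \<exists>W\<subseteq>{..<n}. (\<forall>i. card {v \<in> W. b n v = i} = reserve n) \<and>
        (\<forall>S\<in>profile_sets (b n) W (target \<epsilon> a n). \<not> indep_set E S)} = ?p (\<Union>W\<in>\<W>. ?B W)"
      by (intro arg_cong[where f = ?p]) (auto simp: \<W>_def)
    also have "\<dots> \<le> (\<Sum>W\<in>\<W>. ?p (?B W))"
      by (intro measure_pmf.finite_measure_subadditive_finite fin) auto
    also have "\<dots> \<le> (\<Sum>W\<in>\<W>. exp (- (real n powr (3 / 2) / 6)))"
      by (intro sum_mono) (use elim in \<open>auto simp: \<W>_def\<close>)
    also have "\<dots> \<le> 2 ^ n * exp (- (real n powr (3 / 2) / 6))"
    proof -
      have "card \<W> \<le> card (Pow {..<n})" by (rule card_mono) (auto simp: \<W>_def)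
      then have "card \<W> \<le> 2 ^ n" by (simp add: card_Pow)
      then have "real (card \<W>) \<le> 2 ^ n" by (metis of_nat_le_iff of_nat_numeral of_nat_power)
      then show ?thesis by (simp add: mult_right_mono)
    qed
    finally show ?case .
  qed
  show "(\<lambda>n. 2 ^ n * exp (- (real n powr (3 / 2) / 6))) \<longlonglongrightarrow> 0"
    by real_asymp
qed auto

end

section \<open>The upper bound\<close>

lemma sum_list_sum_swap:
  fixes h :: "'x \<Rightarrow> 'i \<Rightarrow> nat"
  shows "(\<Sum>x\<leftarrow>xs. \<Sum>i\<in>I. h x i) = (\<Sum>i\<in>I. \<Sum>x\<leftarrow>xs. h x i)"
  by (induction xs) (simp_all add: sum.distrib)

section \<open>Counting the colours of the greedy colouring\<close>

context block_model
begin

text \<open>Half the largest admissible multiple of a unit vector. Classes of this shape lie in one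
  block, so the leftovers of the blocks can be treated separately.\<close>

definition single_block :: "'k \<Rightarrow> real ^ 'k" where
  "single_block i = (\<chi> j. if j = i then 1 / wt P i i else 0)"

lemma single_block_admissible: "single_block i \<in> admissible P"
proof -
  have "0 \<le> g P (single_block i) I" for I
  proof (cases "i \<in> I")
    case True
    define J where "J = I - {i}"
    have I: "I = insert i J" "i \<notin> J" using True by (auto simp: J_def)
    have J: "g P (single_block i) J = 0" "(\<Sum>j\<in>J. single_block i $ j * wt P i j) = 0"
      using I(2) by (auto simp: g_eq single_block_def intro!: sum.neutral)
    show ?thesis
      unfolding I(1) g_insert[OF I(2)] J
      using wt_pos[of i i] by (simp add: single_block_def power2_eq_square)
  next
    case False
    then have "single_block i $ j = 0" if "j \<in> I" for j using that by (auto simp: single_block_def)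
    then show ?thesis by (simp add: g_eq)
  qed
  then show ?thesis using wt_pos by (auto simp: admissible_def single_block_def less_imp_le)
qed

text \<open>Classes of shape \<open>a\<close> are used about w a n / (c X) times, n / (c X) classes
  in total; by the convex combination they cover about (1 - \<epsilon>) \<alpha> $ i n vertices of
  block \<open>i\<close>. At most 2 \<epsilon> n vertices per block remain, for which single-block
  classes cost O(\<epsilon> n / X) colours, and \<open>L4\<close> pays for the final singletons.
  \<open>L1\<close> leaves room for the reserve, and \<open>L3\<close> absorbs the rounding
  errors.\<close>

lemma colouring_upper_bound:
  fixes b :: "nat \<Rightarrow> 'k"
  assumes \<alpha>: "\<And>i. 0 < \<alpha> $ i \<and> \<alpha> $ i \<le> 1" and blocks: "block_partition \<alpha> n b"
    and J: "finite J" "J \<subseteq> admissible P" "\<And>a. a \<in> J \<Longrightarrow> 0 \<le> w a" "(\<Sum>a\<in>J. w a) = 1"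
      "(\<Sum>a\<in>J. w a *\<^sub>R a) = c *\<^sub>R \<alpha>"
    and c: "0 < c" and \<epsilon>: "0 < \<epsilon>" "\<epsilon> \<le> 1 / 2"
    and X: "X = ln (real n)" "0 < X" "4 * C \<le> X"
    and ext: "\<And>a W. a \<in> J \<union> range single_block \<Longrightarrow> W \<subseteq> {..<n} \<Longrightarrow> (\<And>i. card {v \<in> W. b v = i} = reserve n) \<Longrightarrow>
      \<exists>S\<in>profile_sets b W (target \<epsilon> a n). indep_set E S"
    and L1: "\<And>i. real (reserve n) + 1 \<le> \<epsilon> * \<alpha> $ i * real n"
    and L3: "1 + real n / (c * X) + (\<Sum>a\<in>J. \<Sum>i\<in>UNIV. a $ i) * X \<le> \<epsilon> * real n"
    and L4: "real CARD('k) * (real (reserve n) + (\<Sum>i\<in>UNIV. 1 / wt P i i) * X) \<le> \<epsilon> * (real n / (c * X))"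
  shows "real (chromatic_number {..<n} E) \<le> real n / (c * X) * (1 + (1 + 8 * real CARD('k) * C * c) * \<epsilon>)"
proof -
  let ?V = "\<lambda>i. card {v \<in> {..<n}. b v = i}"
  let ?m = "reserve n"
  \<comment> \<open>\<open>y\<close> and \<open>x\<close> are the ideal class sizes and
    multiplicities; \<open>s\<close> and \<open>r\<close> are their integer parts.\<close>
  define y where "y a i = (1 - \<epsilon>) * a $ i * X" for a :: "real ^ 'k" and i
  define x where "x a = w a * real n / (c * X)" for a :: "real ^ 'k"
  define s where "s a = target \<epsilon> a n" for a :: "real ^ 'k"
  define r where "r a = nat \<lfloor>x a\<rfloor>" for a
  define \<sigma> where "\<sigma> i = s (single_block i) i" for i
  have a0: "0 \<le> a $ i" if "a \<in> J" for a i using that J(2) by (auto simp: admissible_def)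
  have sy: "real (s a i) \<le> y a i" "y a i - 1 \<le> real (s a i)" "0 \<le> y a i" if "0 \<le> a $ i" for a :: "real ^ 'k" and i
  proof -
    show "0 \<le> y a i" using that \<epsilon> X by (auto simp: y_def)
    then show "real (s a i) \<le> y a i" "y a i - 1 \<le> real (s a i)"
      unfolding s_def target_def y_def X(1) by linarith+
  qed
  have rx: "real (r a) \<le> x a" "x a - 1 \<le> real (r a)" "0 \<le> x a" if "a \<in> J" for a
  proof -
    show "0 \<le> x a" using J(3)[OF that] c X by (auto simp: x_def)
    then show "real (r a) \<le> x a" "x a - 1 \<le> real (r a)"
      unfolding r_def by linarith+
  qed
  have sx: "(\<Sum>a\<in>J. x a) = real n / (c * X)"
    by (simp add: x_def sum_divide_distrib[symmetric] sum_distrib_right[symmetric] J(4))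
  have sxy: "(\<Sum>a\<in>J. x a * y a i) = (1 - \<epsilon>) * \<alpha> $ i * real n" for i
  proof -
    have "(\<Sum>a\<in>J. x a * y a i) = (\<Sum>a\<in>J. (1 - \<epsilon>) * real n / c * (w a * a $ i))"
      using X c by (intro sum.cong refl) (simp add: x_def y_def)
    also have "\<dots> = (1 - \<epsilon>) * real n / c * (\<Sum>a\<in>J. w a * a $ i)" by (simp only: sum_distrib_left)
    also have "(\<Sum>a\<in>J. w a * a $ i) = c * \<alpha> $ i"
      using arg_cong[OF J(5), of "\<lambda>z. z $ i"] by (simp add: sum_component)
    finally show ?thesis using c by simp
  qed
  have Vi: "\<bar>real (?V i) - \<alpha> $ i * real n\<bar> < 1" for i
    using blocks by (simp add: block_partition_def)
  define R where "R i = (\<Sum>a\<in>J. r a * s a i)" for i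
  have R_le: "real (R i) \<le> (1 - \<epsilon>) * \<alpha> $ i * real n" for i
  proof -
    have "real (R i) \<le> (\<Sum>a\<in>J. x a * y a i)"
      unfolding R_def of_nat_sum of_nat_mult
      by (intro sum_mono mult_mono rx sy a0) auto
    then show ?thesis by (simp add: sxy)
  qed
  have R_ge: "(1 - \<epsilon>) * \<alpha> $ i * real n - real n / (c * X) - (\<Sum>a\<in>J. \<Sum>i\<in>UNIV. a $ i) * X \<le> real (R i)" for i
  proof -
    \<comment> \<open>Rounding the class sizes loses at most \<open>x a\<close>, and rounding the
      multiplicity loses at most one class, that is \<open>y a i\<close>.\<close>
    have "(\<Sum>a\<in>J. x a * y a i - x a - (\<Sum>i\<in>UNIV. a $ i) * X) \<le> (\<Sum>a\<in>J. real (r a) * real (s a i))"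
    proof (rule sum_mono)
      fix a assume a: "a \<in> J"
      note rx = rx[OF a] and sy = sy[OF a0[OF a], of i]
      have "0 \<le> x a * (real (s a i) - (y a i - 1))"
        using rx sy by (intro mult_nonneg_nonneg) auto
      moreover have "(x a - real (r a)) * real (s a i) \<le> 1 * y a i"
        using rx sy by (intro mult_mono) auto
      ultimately have "x a * y a i - x a - y a i \<le> real (r a) * real (s a i)" by (simp add: algebra_simps)
      moreover have "y a i \<le> (\<Sum>i\<in>UNIV. a $ i) * X"
      proof -
        have "(1 - \<epsilon>) * a $ i \<le> 1 * a $ i" using \<epsilon> a0[OF a] by (intro mult_right_mono) auto
        also have "\<dots> \<le> (\<Sum>i\<in>UNIV. a $ i)" using a0[OF a] by (simp add: member_le_sum)
        finally show ?thesis unfolding y_def using X by (intro mult_right_mono) auto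
      qed
      ultimately show "x a * y a i - x a - (\<Sum>i\<in>UNIV. a $ i) * X \<le> real (r a) * real (s a i)" by linarith
    qed
    then show ?thesis by (simp add: R_def sum_subtractf sxy sx sum_distrib_right)
  qed
  have RV: "R i + ?m \<le> ?V i" for i
  proof -
    have "real (R i) + real ?m \<le> \<alpha> $ i * real n - 1"
      using R_le[of i] L1[of i] by (simp add: algebra_simps)
    also have "\<dots> \<le> real (?V i)" using Vi[of i] by linarith
    finally show ?thesis by linarith
  qed
  define rest where "rest i = ?V i - R i" for i
  have rest_le: "real (rest i) \<le> 2 * \<epsilon> * real n" for i
  proof -
    have "real (rest i) = real (?V i) - real (R i)" using RV[of i] by (simp add: rest_def)
    also have "\<dots> \<le> \<alpha> $ i * real n + 1 - ((1 - \<epsilon>) * \<alpha> $ i * real n - real n / (c * X) - (\<Sum>a\<in>J. \<Sum>i\<in>UNIV. a $ i) * X)"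
      using Vi[of i] R_ge[of i] by linarith
    also have "\<dots> = \<epsilon> * \<alpha> $ i * real n + (1 + real n / (c * X) + (\<Sum>a\<in>J. \<Sum>i\<in>UNIV. a $ i) * X)"
      by (simp add: algebra_simps)
    also have "\<dots> \<le> \<epsilon> * 1 * real n + \<epsilon> * real n"
      using \<alpha>[of i] \<epsilon> by (intro add_mono L3 mult_right_mono mult_left_mono) auto
    finally show ?thesis by simp
  qed
  have single_block_nonneg: "0 \<le> single_block j $ i" for i j using wt_pos[of j j] by (simp add: single_block_def)
  \<comment> \<open>The unrounded size is at least X / (2 C); since 4 C \<le> X, rounding costs at
    most half of that.\<close>
  have \<sigma>_ge: "X / (4 * C) \<le> real (\<sigma> i)" for i
  proof -
    have "1 / C \<le> 1 / wt P i i" using C[of i i] wt_pos[of i i] by (intro divide_left_mono) (auto simp: C_pos)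
    then have "1 / 2 * (1 / C) * X \<le> (1 - \<epsilon>) * (1 / wt P i i) * X"
      using \<epsilon> X C_pos by (intro mult_right_mono mult_mono) auto
    also have "\<dots> = y (single_block i) i" by (simp add: y_def single_block_def)
    also have "\<dots> \<le> real (\<sigma> i) + 1" using sy(2)[OF single_block_nonneg, of i i] by (simp add: \<sigma>_def)
    finally show ?thesis using X(3) C_pos by (simp add: field_simps)
  qed
  have \<sigma>_le: "real (\<sigma> i) \<le> (\<Sum>i\<in>UNIV. 1 / wt P i i) * X" for i
  proof -
    have "real (\<sigma> i) \<le> y (single_block i) i" using sy(1)[OF single_block_nonneg, of i i] by (simp add: \<sigma>_def)
    also have "\<dots> = (1 - \<epsilon>) * (1 / wt P i i) * X" by (simp add: y_def single_block_def)
    also have "\<dots> \<le> 1 * (\<Sum>i\<in>UNIV. 1 / wt P i i) * X"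
      using \<epsilon> X wt_pos by (intro mult_right_mono mult_mono member_le_sum[of i UNIV "\<lambda>i. 1 / wt P i i"]) (auto simp: less_imp_le)
    finally show ?thesis by simp
  qed
  have \<sigma>0: "0 < \<sigma> i" for i
  proof -
    have "0 < X / (4 * C)" using X C_pos by simp
    then show ?thesis using \<sigma>_ge[of i] by linarith
  qed
  \<comment> \<open>As many single-block classes as fit while \<open>?m\<close> vertices stay
    behind; the uncovered part is at most \<open>?m + \<sigma> i\<close>.\<close>
  define u where "u i = (rest i - ?m) div \<sigma> i" for i
  have u1: "u i * \<sigma> i + ?m \<le> rest i" for i
  proof -
    have "?m \<le> rest i" using RV[of i] by (simp add: rest_def)
    moreover have "u i * \<sigma> i \<le> rest i - ?m" by (simp add: u_def)
    ultimately show ?thesis by simp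
  qed
  have u2: "rest i - u i * \<sigma> i \<le> ?m + \<sigma> i" for i
  proof -
    have "rest i - ?m < u i * \<sigma> i + \<sigma> i"
      unfolding u_def using dividend_less_div_times[OF \<sigma>0[of i]] by (simp add: add.commute)
    then show ?thesis by simp
  qed
  have u3: "real (u i) \<le> 8 * C * \<epsilon> * real n / X" for i
  proof -
    have "real (u i) * (X / (4 * C)) \<le> real (u i) * real (\<sigma> i)" by (intro mult_left_mono \<sigma>_ge) auto
    also have "\<dots> \<le> real (rest i)" using u1[of i] by (simp flip: of_nat_mult)
    also have "\<dots> \<le> 2 * \<epsilon> * real n" by (rule rest_le)
    finally show ?thesis using X C_pos by (simp add: field_simps)
  qed
  obtain ss1 where ss1: "set ss1 \<subseteq> s ` J" "length ss1 = (\<Sum>a\<in>J. r a)" "\<And>i. (\<Sum>t\<leftarrow>ss1. t i) = R i"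
    using exists_list_with_multiplicities[OF J(1), of s r] unfolding R_def by blast
  obtain ss2 where ss2: "set ss2 \<subseteq> (\<lambda>j. s (single_block j)) ` UNIV" "length ss2 = (\<Sum>j\<in>UNIV. u j)"
      "\<And>i. (\<Sum>t\<leftarrow>ss2. t i) = (\<Sum>j\<in>UNIV. u j * s (single_block j) i)"
    using exists_list_with_multiplicities[of UNIV "\<lambda>j. s (single_block j)" u] by auto
  have ss2': "(\<Sum>t\<leftarrow>ss2. t i) = u i * \<sigma> i" for i
  proof -
    \<comment> \<open>The target of \<open>single_block j\<close> is zero in every block other than
      \<open>j\<close>.\<close>
    have "(\<Sum>j\<in>UNIV. u j * s (single_block j) i) = (\<Sum>j\<in>UNIV. if j = i then u i * \<sigma> i else 0)"
      by (intro sum.cong refl) (auto simp: \<sigma>_def s_def target_def single_block_def)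
    then show ?thesis by (simp add: ss2(3))
  qed
  define ss where "ss = ss1 @ ss2"
  have ssi: "(\<Sum>t\<leftarrow>ss. t i) = R i + u i * \<sigma> i" for i by (simp add: ss_def ss1(3) ss2')
  have cap: "(\<Sum>t\<leftarrow>ss. t i) + ?m \<le> ?V i" for i
    using u1[of i] RV[of i] by (simp add: ssi rest_def)
  have "\<exists>f. proper_coloring {..<n} E (length ss + (card {..<n} - (\<Sum>t\<leftarrow>ss. \<Sum>i\<in>UNIV. t i))) f"
  proof (rule greedy_colouring)
    fix t W assume t: "t \<in> set ss" and W: "W \<subseteq> {..<n}" and Wm: "\<And>i. ?m \<le> card {v \<in> W. b v = i}"
    have "t \<in> set ss1 \<union> set ss2" using t by (simp add: ss_def)
    also have "\<dots> \<subseteq> s ` (J \<union> range single_block)"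
      unfolding image_Un image_image using ss1(1) ss2(1) by (rule Un_mono)
    finally obtain a where a: "t = s a" "a \<in> J \<union> range single_block" by (rule imageE)
    \<comment> \<open>\<open>ext\<close> speaks of exactly \<open>?m\<close> vertices per block, so
      \<open>W\<close> is first thinned out block by block.\<close>
    have "\<exists>Y. Y \<subseteq> {v \<in> W. b v = i} \<and> card Y = ?m" for i
    proof -
      obtain Z where "Z \<subseteq> {v \<in> W. b v = i}" "card Z = ?m"
        by (rule obtain_subset_with_card_n[OF Wm[of i]])
      then show ?thesis by blast
    qed
    then have "\<forall>i. \<exists>Y. Y \<subseteq> {v \<in> W. b v = i} \<and> card Y = ?m" by (rule allI)
    from choice[OF this] obtain Y where "\<forall>i. Y i \<subseteq> {v \<in> W. b v = i} \<and> card (Y i) = ?m" ..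
    then have Y: "Y i \<subseteq> {v \<in> W. b v = i}" "card (Y i) = ?m" for i by simp_all
    define U where "U = (\<Union>j. Y j)"
    have "{v \<in> U. b v = i} = Y i" for i
      unfolding U_def using Y(1)[THEN subsetD] by (intro equalityI subsetI) auto
    then have cU: "card {v \<in> U. b v = i} = ?m" for i by (simp add: Y(2))
    have UW: "U \<subseteq> W" unfolding U_def using Y(1)[THEN subsetD] by (intro UN_least subsetI) auto
    have "\<exists>S\<in>profile_sets b U t. indep_set E S"
      unfolding a(1) s_def by (rule ext[OF a(2) order_trans[OF UW W] cU])
    then show "\<exists>S\<in>profile_sets b W t. indep_set E S"
      using UW unfolding profile_sets_def by blast
  qed (use cap in auto)
  then have "chromatic_number {..<n} E \<le> length ss + (card {..<n} - (\<Sum>t\<leftarrow>ss. \<Sum>i\<in>UNIV. t i))"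
    unfolding chromatic_number_def by (rule Least_le)
  also have "card {..<n} - (\<Sum>t\<leftarrow>ss. \<Sum>i\<in>UNIV. t i) = (\<Sum>i\<in>UNIV. rest i - u i * \<sigma> i)"
  proof -
    have "card {..<n} = (\<Sum>i\<in>UNIV. ?V i)"
      using sum.group[of "{..<n}" UNIV b "\<lambda>_. 1::nat"] by simp
    moreover have "(\<Sum>i\<in>UNIV. ?V i) - (\<Sum>i\<in>UNIV. R i + u i * \<sigma> i) = (\<Sum>i\<in>UNIV. ?V i - (R i + u i * \<sigma> i))"
    proof (rule sum_subtractf_nat[symmetric])
      show "R i + u i * \<sigma> i \<le> ?V i" for i using cap[of i] by (simp add: ssi)
    qed
    ultimately show ?thesis by (simp add: sum_list_sum_swap ssi rest_def)
  qed
  finally have "real (chromatic_number {..<n} E) \<le> real (length ss + (\<Sum>i\<in>UNIV. rest i - u i * \<sigma> i))"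
    by (rule of_nat_mono)
  also have "\<dots> = (\<Sum>a\<in>J. real (r a)) + (\<Sum>i\<in>UNIV. real (u i)) + (\<Sum>i\<in>UNIV. real (rest i - u i * \<sigma> i))"
    by (simp add: ss_def ss1(2) ss2(2))
  \<comment> \<open>The three sums count the main classes, the single-block classes and the private
    colours.\<close>
  also have "\<dots> \<le> (\<Sum>a\<in>J. x a) + (\<Sum>i\<in>(UNIV::'k set). 8 * C * \<epsilon> * real n / X) +
      (\<Sum>i\<in>(UNIV::'k set). real ?m + (\<Sum>i\<in>UNIV. 1 / wt P i i) * X)"
  proof (intro add_mono sum_mono rx u3)
    fix i
    have "real (rest i - u i * \<sigma> i) \<le> real (?m + \<sigma> i)" using u2 by (intro of_nat_mono)
    then show "real (rest i - u i * \<sigma> i) \<le> real ?m + (\<Sum>i\<in>UNIV. 1 / wt P i i) * X"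
      using \<sigma>_le[of i] by simp
  qed
  also have "\<dots> \<le> real n / (c * X) + real CARD('k) * (8 * C * \<epsilon> * real n / X) + \<epsilon> * (real n / (c * X))"
    using L4 by (simp add: sx)
  also have "\<dots> = real n / (c * X) * (1 + (1 + 8 * real CARD('k) * C * c) * \<epsilon>)"
    using c X by (simp add: field_simps)
  finally show ?thesis .
qed

end

text \<open>Diagonal choice: for each \<open>n\<close> take essentially the smallest \<epsilon> with
  failure probability at most \<epsilon>. Convergence for every fixed \<epsilon> forces these values
  to 0.\<close>

lemma exists_slow_rate:
  fixes p :: "nat \<Rightarrow> real \<Rightarrow> real"
  assumes lim: "\<And>\<epsilon>. 0 < \<epsilon> \<Longrightarrow> (\<lambda>n. p n \<epsilon>) \<longlonglongrightarrow> 1"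
    and mono: "\<And>n x y. x \<le> y \<Longrightarrow> p n x \<le> p n y" and bounds: "\<And>n x. 0 \<le> p n x" "\<And>n x. p n x \<le> 1"
  shows "\<exists>\<delta>. \<delta> \<longlonglongrightarrow> 0 \<and> (\<lambda>n. p n (\<delta> n)) \<longlonglongrightarrow> 1"
proof -
  define A where "A n = {\<epsilon>. 0 \<le> \<epsilon> \<and> 1 - \<epsilon> \<le> p n \<epsilon>}" for n
  have A1: "1 \<in> A n" for n using bounds(1)[of n 1] by (simp add: A_def)
  have Ab: "bdd_below (A n)" for n by (rule bdd_belowI[of _ 0]) (simp add: A_def)
  have I0: "0 \<le> Inf (A n)" for n
  proof (rule cInf_greatest)
    show "A n \<noteq> {}" using A1[of n] by blast
  qed (simp add: A_def)
  \<comment> \<open>The infimum need not be attained; a vanishing positive amount puts \<delta> n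
    strictly above some element of \<open>A n\<close>, and monotonicity does the rest.\<close>
  define \<delta> where "\<delta> n = Inf (A n) + 1 / real (Suc n)" for n
  have "(\<lambda>n. Inf (A n)) \<longlonglongrightarrow> 0"
  proof (rule LIMSEQ_I)
    fix r :: real assume r: "0 < r"
    have "\<forall>\<^sub>F n in sequentially. 1 - r / 2 < p n (r / 2)"
      using r by (intro order_tendstoD(1)[OF lim]) auto
    then obtain N where N: "\<And>n. N \<le> n \<Longrightarrow> 1 - r / 2 < p n (r / 2)"
      by (auto simp: eventually_sequentially)
    have "norm (Inf (A n) - 0) < r" if "N \<le> n" for n
    proof -
      have "r / 2 \<in> A n" using N[OF that] r by (auto simp: A_def)
      then have "Inf (A n) \<le> r / 2" by (intro cInf_lower Ab)
      then show ?thesis using I0[of n] r by simp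
    qed
    then show "\<exists>N. \<forall>n\<ge>N. norm (Inf (A n) - 0) < r" by blast
  qed
  moreover have "(\<lambda>n. 1 / real (Suc n)) \<longlonglongrightarrow> 0" using LIMSEQ_inverse_real_of_nat by (simp add: divide_inverse)
  ultimately have \<delta>: "\<delta> \<longlonglongrightarrow> 0" unfolding \<delta>_def by (rule tendsto_add_zero)
  have "1 - \<delta> n \<le> p n (\<delta> n)" for n
  proof -
    have "Inf (A n) < \<delta> n" by (simp add: \<delta>_def)
    then obtain x where x: "x \<in> A n" "x < \<delta> n"
      using cInf_lessD[of "A n"] A1[of n] by blast
    then show ?thesis using mono[of x "\<delta> n" n] by (auto simp: A_def)
  qed
  moreover have "(\<lambda>n. 1 - \<delta> n) \<longlonglongrightarrow> 1" using tendsto_diff[OF tendsto_const \<delta>, of 1] by simp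
  ultimately have "(\<lambda>n. p n (\<delta> n)) \<longlonglongrightarrow> 1"
    by (intro tendsto_sandwich[of "\<lambda>n. 1 - \<delta> n" "\<lambda>n. p n (\<delta> n)" sequentially "\<lambda>_. 1"]) (auto simp: bounds)
  then show ?thesis using \<delta> by blast
qed


text \<open>(1 + x)^n \<le> exp (n x), and here n x is a constant times n^(1 - \<kappa>), which
  tends to 0.\<close>

lemma tendsto_first_moment_bound:
  fixes C \<kappa> :: real
  assumes "1 < \<kappa>"
  shows "(\<lambda>n. (1 + exp (C / 2 - \<kappa> * ln (real n))) ^ n - 1) \<longlonglongrightarrow> 0"
proof (rule tendsto_sandwich[where f = "\<lambda>_. 0" and h = "\<lambda>n. exp (real n * exp (C / 2 - \<kappa> * ln (real n))) - 1"])
  show "\<forall>\<^sub>F n in sequentially. (1 + exp (C / 2 - \<kappa> * ln (real n))) ^ n - 1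
      \<le> exp (real n * exp (C / 2 - \<kappa> * ln (real n))) - 1"
  proof (intro always_eventually allI)
    fix n
    have "(1 + exp (C / 2 - \<kappa> * ln (real n))) ^ n \<le> exp (exp (C / 2 - \<kappa> * ln (real n))) ^ n"
      by (intro power_mono exp_ge_add_one_self) (auto intro: add_nonneg_nonneg)
    then show "(1 + exp (C / 2 - \<kappa> * ln (real n))) ^ n - 1 \<le> exp (real n * exp (C / 2 - \<kappa> * ln (real n))) - 1"
      by (simp add: exp_of_nat_mult)
  qed
  show "(\<lambda>n. exp (real n * exp (C / 2 - \<kappa> * ln (real n))) - 1) \<longlonglongrightarrow> 0"
    using assms by real_asymp
qed (auto intro!: always_eventually one_le_power)

section \<open>Concentration up to a fixed relative error\<close>

context block_model
begin

text \<open>Outside the event \<open>B1\<close> and the finitely many events \<open>B2 a n\<close>,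
  all of vanishing probability, the two deterministic bounds \<open>colouring_lower_bound\<close>
  and \<open>colouring_upper_bound\<close> place the chromatic number within the factors 1 -
  \<epsilon> and 1 + \<epsilon> of n / (c ln n).\<close>

lemma chromatic_concentration:
  fixes \<alpha> :: "real ^ 'k" and b :: "nat \<Rightarrow> nat \<Rightarrow> 'k"
  assumes \<alpha>: "\<And>i. 0 < \<alpha> $ i \<and> \<alpha> $ i \<le> 1" "(\<Sum>i\<in>UNIV. \<alpha> $ i) = 1"
    and blocks: "\<And>n. block_partition \<alpha> n (b n)" and \<epsilon>: "0 < \<epsilon>"
  shows "(\<lambda>n. measure_pmf.prob (random_block_graph n (b n) P)
           {E. \<exists>\<eta>. \<bar>\<eta>\<bar> \<le> \<epsilon> \<and>
               real (chromatic_number {..<n} E) = (1 + \<eta>) * (real n / (cstar \<alpha> P * ln (real n)))})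
      \<longlonglongrightarrow> 1"
proof -
  define c where "c = cstar \<alpha> P"
  have \<alpha>0: "0 \<le> \<alpha> $ i" for i using \<alpha>(1)[of i] by simp
  have c: "0 < c" unfolding c_def by (rule cstar_pos[OF \<alpha>0 \<alpha>(2)])
  obtain J w where J: "finite J" "J \<subseteq> admissible P" "\<And>a. a \<in> J \<Longrightarrow> 0 \<le> w a" "(\<Sum>a\<in>J. w a) = 1"
      "(\<Sum>a\<in>J. w a *\<^sub>R a) = c *\<^sub>R \<alpha>"
    using cstar_mem[OF \<alpha>0 \<alpha>(2)] unfolding c_def[symmetric] convex_hull_explicit by blast
  define J' where "J' = J \<union> range single_block"
  have J': "finite J'" "J' \<subseteq> admissible P" using J single_block_admissible by (auto simp: J'_def)
  \<comment> \<open>The coefficient of the error in \<open>colouring_upper_bound\<close>;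
    \<epsilon>' is chosen so that K \<epsilon>' \<le> \<epsilon>.\<close>
  define K where "K = 1 + 8 * real CARD('k) * C * c"
  have K: "0 < K" using C_pos c by (auto simp: K_def intro!: add_pos_nonneg)
  define \<epsilon>' where "\<epsilon>' = min (1 / 2) (\<epsilon> / K)"
  have \<epsilon>': "0 < \<epsilon>'" "\<epsilon>' \<le> 1 / 2" "K * \<epsilon>' \<le> \<epsilon>" using \<epsilon> K by (auto simp: \<epsilon>'_def min_def field_simps)
  \<comment> \<open>One factor 1 - \<delta> is lost in the scaling \<open>?\<theta>\<close>, another
    in the rounding of the block sizes; hence the requirement on the square.\<close>
  define \<delta> where "\<delta> = min (1 / 2) (\<epsilon> / 2)"
  have \<delta>: "0 < \<delta>" "\<delta> < 1" "1 - \<epsilon> \<le> (1 - \<delta>)\<^sup>2"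
  proof -
    show "0 < \<delta>" "\<delta> < 1" using \<epsilon> by (auto simp: \<delta>_def)
    have "1 - \<epsilon> \<le> 1 - 2 * \<delta>" using \<epsilon> by (auto simp: \<delta>_def)
    also have "\<dots> \<le> (1 - \<delta>)\<^sup>2" by (simp add: power2_eq_square algebra_simps)
    finally show "1 - \<epsilon> \<le> (1 - \<delta>)\<^sup>2" .
  qed
  define S where "S = (\<Sum>a\<in>J. \<Sum>i\<in>UNIV. a $ i)"
  define D where "D = (\<Sum>i\<in>UNIV. 1 / wt P i i)"
  let ?p = "\<lambda>n. measure_pmf.prob (random_block_graph n (b n) P)"
  let ?\<theta> = "\<lambda>n. (1 - \<delta>) / ln (real n)"
  define B1 where "B1 n = {E. \<exists>S\<subseteq>{..<n}. S \<noteq> {} \<and> indep_set E S \<and>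
    real (card S) < ?\<theta> n / 2 * quad P (profile (b n) S)}" for n
  define B2 where "B2 a n = {E. \<exists>W\<subseteq>{..<n}. (\<forall>i. card {v \<in> W. b n v = i} = reserve n) \<and>
        (\<forall>S\<in>profile_sets (b n) W (target \<epsilon>' a n). \<not> indep_set E S)}" for a n
  define G where "G n = {E. \<exists>\<eta>. \<bar>\<eta>\<bar> \<le> \<epsilon> \<and>
      real (chromatic_number {..<n} E) = (1 + \<eta>) * (real n / (c * ln (real n)))}" for n
  have ln1: "\<forall>\<^sub>F n in sequentially. max 1 (4 * C) \<le> ln (real n)" by real_asymp
  have B1: "(\<lambda>n. ?p n (B1 n)) \<longlonglongrightarrow> 0"
  proof (rule tendsto_sandwich[where f = "\<lambda>_. 0" and h = "\<lambda>n. (1 + exp (C / 2 - 1 / (1 - \<delta>) * ln (real n))) ^ n - 1"])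
    show "\<forall>\<^sub>F n in sequentially. ?p n (B1 n) \<le> (1 + exp (C / 2 - 1 / (1 - \<delta>) * ln (real n))) ^ n - 1"
      using ln1
    proof eventually_elim
      case (elim n)
      then have "0 < ?\<theta> n" using \<delta> by simp
      from prob_large_indep_set_le[OF this, of n "b n"] show ?case by (simp add: B1_def)
    qed
    show "(\<lambda>n. (1 + exp (C / 2 - 1 / (1 - \<delta>) * ln (real n))) ^ n - 1) \<longlonglongrightarrow> 0"
      using \<delta> by (intro tendsto_first_moment_bound) simp
  qed auto
  have B2: "(\<lambda>n. ?p n (B2 a n)) \<longlonglongrightarrow> 0" if "a \<in> J'" for a
    unfolding B2_def using that J'(2) \<epsilon>' by (intro prob_some_subset_no_target_set) auto
  have "(\<lambda>n. ?p n (B1 n) + (\<Sum>a\<in>J'. ?p n (B2 a n))) \<longlonglongrightarrow> 0 + (\<Sum>a\<in>J'. 0)"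
    by (intro tendsto_add tendsto_sum B1 B2)
  then have lim: "(\<lambda>n. 1 - (?p n (B1 n) + (\<Sum>a\<in>J'. ?p n (B2 a n)))) \<longlonglongrightarrow> 1"
    using tendsto_diff[OF tendsto_const[of 1]] by fastforce
  have L1: "\<forall>\<^sub>F n in sequentially. \<forall>i\<in>UNIV. real n / (ln (real n))\<^sup>2 + 2 \<le> \<epsilon>' * \<alpha> $ i * real n"
  proof (rule eventually_ball_finite)
    show "\<forall>i\<in>UNIV. \<forall>\<^sub>F n in sequentially. real n / (ln (real n))\<^sup>2 + 2 \<le> \<epsilon>' * \<alpha> $ i * real n"
    proof
      fix i
      have "0 < \<epsilon>' * \<alpha> $ i" using \<epsilon>' \<alpha>(1)[of i] by simp
      then show "\<forall>\<^sub>F n in sequentially. real n / (ln (real n))\<^sup>2 + 2 \<le> \<epsilon>' * \<alpha> $ i * real n"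
        by real_asymp
    qed
  qed simp
  have L2: "\<forall>\<^sub>F n in sequentially. \<forall>i\<in>UNIV. 1 \<le> \<delta> * \<alpha> $ i * real n"
  proof (rule eventually_ball_finite)
    show "\<forall>i\<in>UNIV. \<forall>\<^sub>F n in sequentially. 1 \<le> \<delta> * \<alpha> $ i * real n"
    proof
      fix i
      have "0 < \<delta> * \<alpha> $ i" using \<delta> \<alpha>(1)[of i] by simp
      then show "\<forall>\<^sub>F n in sequentially. 1 \<le> \<delta> * \<alpha> $ i * real n" by real_asymp
    qed
  qed simp
  have L3: "\<forall>\<^sub>F n in sequentially. 1 + real n / (c * ln (real n)) + S * ln (real n) \<le> \<epsilon>' * real n"
  proof -
    have "\<forall>\<^sub>F n in sequentially. 1 + real n / (c * ln (real n)) + (\<bar>S\<bar> + 1) * ln (real n) \<le> \<epsilon>' * real n"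
      using \<epsilon>'(1) c by real_asymp
    with ln1 show ?thesis
    proof eventually_elim
      case (elim n)
      have "S * ln (real n) \<le> (\<bar>S\<bar> + 1) * ln (real n)" using elim(1) by (intro mult_right_mono) auto
      then show ?case using elim(2) by linarith
    qed
  qed
  have L4: "\<forall>\<^sub>F n in sequentially. real CARD('k) * (real n / (ln (real n))\<^sup>2 + 1 + D * ln (real n))
      \<le> \<epsilon>' * (real n / (c * ln (real n)))"
  proof -
    have "0 < D" unfolding D_def using wt_pos by (intro sum_pos) auto
    moreover have "0 < real CARD('k)" by simp
    ultimately show ?thesis using \<epsilon>'(1) c by real_asymp
  qed
  have "\<forall>\<^sub>F n in sequentially. 1 - (?p n (B1 n) + (\<Sum>a\<in>J'. ?p n (B2 a n))) \<le> ?p n (G n)"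
    using ln1 L1 L2 L3 L4
  proof eventually_elim
    case (elim n)
    define X where "X = ln (real n)"
    have X: "0 < X" "4 * C \<le> X" using elim(1) by (auto simp: X_def)
    have n0: "0 < n" using X by (cases "n = 0") (auto simp: X_def)
    have m: "real (reserve n) \<le> real n / X\<^sup>2 + 1"
    proof -
      have "0 \<le> real n / X\<^sup>2" by simp
      then show ?thesis unfolding reserve_def X_def by linarith
    qed
    have good: "E \<in> G n" if E: "E \<notin> B1 n" "\<And>a. a \<in> J' \<Longrightarrow> E \<notin> B2 a n" for E
    proof -
      define q where "q = real (chromatic_number {..<n} E)"
      define z where "z = real n / (c * X)"
      have z: "0 < z" using n0 c X by (simp add: z_def)
      \<comment> \<open>Some proper colouring exists, so the least number of colours is
        attained.\<close>
      have "proper_coloring {..<n} E n id" by (auto simp: proper_coloring_def)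
      then have "\<exists>f. proper_coloring {..<n} E (chromatic_number {..<n} E) f"
        unfolding chromatic_number_def by (intro LeastI[of "\<lambda>q. \<exists>f. proper_coloring {..<n} E q f"]) blast
      then obtain f where f: "proper_coloring {..<n} E (chromatic_number {..<n} E) f" by blast
      have "(1 - \<delta>)\<^sup>2 * real n / X \<le> q * cstar \<alpha> P"
        unfolding q_def
      proof (rule colouring_lower_bound[OF \<alpha>0 \<alpha>(2) _ _ _ _ f])
        show "0 < (1 - \<delta>) / X" using \<delta> X by simp
        show "(1 - \<delta>) / X / 2 * quad P (profile (b n) S) \<le> real (card S)"
          if "S \<subseteq> {..<n}" "S \<noteq> {}" "indep_set E S" for S
          using E(1) that unfolding B1_def X_def by (auto simp: not_less)
        show "(1 - \<delta>)\<^sup>2 * real n / X * \<alpha> $ i \<le> (1 - \<delta>) / X * profile (b n) {..<n} $ i" for i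
        proof -
          have "(1 - \<delta>) * real n * \<alpha> $ i \<le> \<alpha> $ i * real n - 1"
            using elim(3) by (simp add: algebra_simps)
          also have "\<dots> \<le> profile (b n) {..<n} $ i"
            using blocks[of n] unfolding block_partition_def profile_def by (simp add: abs_less_iff) (metis add.commute diff_le_eq less_imp_le)
          finally have "(1 - \<delta>) / X * ((1 - \<delta>) * real n * \<alpha> $ i) \<le> (1 - \<delta>) / X * profile (b n) {..<n} $ i"
            using \<delta> X by (intro mult_left_mono) auto
          then show ?thesis by (simp add: power2_eq_square mult_ac)
        qed
      qed (use n0 X in auto)
      then have "(1 - \<delta>)\<^sup>2 * z \<le> q" using c X by (simp add: z_def c_def[symmetric] field_simps)
      moreover have "(1 - \<epsilon>) * z \<le> (1 - \<delta>)\<^sup>2 * z" using \<delta>(3) z by (intro mult_right_mono) auto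
      ultimately have lower: "(1 - \<epsilon>) * z \<le> q" by linarith
      have "q \<le> z * (1 + K * \<epsilon>')"
        unfolding q_def z_def K_def
      proof (rule colouring_upper_bound[OF \<alpha>(1) blocks[of n] J c \<epsilon>'(1,2) X_def X])
        show "\<exists>S\<in>profile_sets (b n) W (target \<epsilon>' a n). indep_set E S"
          if "a \<in> J \<union> range single_block" "W \<subseteq> {..<n}" "\<And>i. card {v \<in> W. b n v = i} = reserve n" for a W
          using E(2)[of a] that by (auto simp: J'_def B2_def)
        show "real (reserve n) + 1 \<le> \<epsilon>' * \<alpha> $ i * real n" for i
        proof -
          have "real n / X\<^sup>2 + 2 \<le> \<epsilon>' * \<alpha> $ i * real n" using elim(2) by (simp add: X_def)
          then show ?thesis using m by linarith
        qed
        show "1 + real n / (c * X) + (\<Sum>a\<in>J. \<Sum>i\<in>UNIV. a $ i) * X \<le> \<epsilon>' * real n"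
          using elim(4) by (simp add: S_def X_def)
        have "real CARD('k) * (real (reserve n) + D * X) \<le> real CARD('k) * (real n / X\<^sup>2 + 1 + D * X)"
          using m by (intro mult_left_mono) auto
        also have "\<dots> \<le> \<epsilon>' * (real n / (c * X))" using elim(5) by (simp only: X_def)
        finally show "real CARD('k) * (real (reserve n) + (\<Sum>i\<in>UNIV. 1 / wt P i i) * X) \<le> \<epsilon>' * (real n / (c * X))"
          by (simp only: D_def)
      qed
      also have "\<dots> \<le> z * (1 + \<epsilon>)" using \<epsilon>' z by (intro mult_left_mono) auto
      finally have upper: "q \<le> (1 + \<epsilon>) * z" by (simp add: mult.commute)
      have "\<bar>q / z - 1\<bar> \<le> \<epsilon>" using lower upper z by (auto simp: abs_le_iff field_simps)
      moreover have "q = (1 + (q / z - 1)) * z" using z by simp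
      ultimately have "\<exists>\<eta>. \<bar>\<eta>\<bar> \<le> \<epsilon> \<and> q = (1 + \<eta>) * z" by (intro exI[of _ "q / z - 1"] conjI)
      then show ?thesis by (simp only: G_def mem_Collect_eq q_def z_def X_def)
    qed
    have "1 = ?p n UNIV" by simp
    also have "\<dots> \<le> ?p n (G n \<union> (B1 n \<union> (\<Union>a\<in>J'. B2 a n)))"
      by (intro measure_pmf.finite_measure_mono) (use good in auto)
    also have "\<dots> \<le> ?p n (G n) + ?p n (B1 n \<union> (\<Union>a\<in>J'. B2 a n))"
      by (rule measure_Un_le) auto
    finally have "1 \<le> ?p n (G n) + ?p n (B1 n \<union> (\<Union>a\<in>J'. B2 a n))" .
    moreover have "?p n (B1 n \<union> (\<Union>a\<in>J'. B2 a n)) \<le> ?p n (B1 n) + ?p n (\<Union>a\<in>J'. B2 a n)"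
      by (rule measure_Un_le) auto
    moreover have "?p n (\<Union>a\<in>J'. B2 a n) \<le> (\<Sum>a\<in>J'. ?p n (B2 a n))"
      by (intro measure_pmf.finite_measure_subadditive_finite J') auto
    ultimately show ?case by linarith
  qed
  then have "(\<lambda>n. ?p n (G n)) \<longlonglongrightarrow> 1"
    by (intro tendsto_sandwich[OF _ _ lim tendsto_const]) auto
  then show ?thesis by (simp add: G_def c_def)
qed

end

theorem theorem1p1:
  fixes \<alpha> :: "real ^ 'k" and P :: "real ^ 'k ^ 'k" and b :: "nat \<Rightarrow> nat \<Rightarrow> 'k"
  assumes alpha: "\<And>i. 0 < \<alpha> $ i \<and> \<alpha> $ i \<le> 1" "(\<Sum>i\<in>UNIV. \<alpha> $ i) = 1"
    and P: "transpose P = P" "\<And>i j. 0 < P $ i $ j \<and> P $ i $ j < 1"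
    and blocks: "\<And>n. block_partition \<alpha> n (b n)"
  shows "\<exists>\<delta> :: nat \<Rightarrow> real. \<delta> \<longlonglongrightarrow> 0 \<and>
    (\<lambda>n. measure_pmf.prob (random_block_graph n (b n) P)
           {E. \<exists>\<eta>. \<bar>\<eta>\<bar> \<le> \<delta> n \<and>
               real (chromatic_number {..<n} E) = (1 + \<eta>) * (real n / (cstar \<alpha> P * ln (real n)))})
      \<longlonglongrightarrow> 1"
proof -
  \<comment> \<open>The weights are nonnegative, so their total bounds each of them.\<close>
  define C where "C = (\<Sum>i\<in>UNIV. \<Sum>j\<in>UNIV. wt P i j)"
  have w: "0 \<le> wt P i j" for i j using P(2)[of i j] by (simp add: wt_def)
  have "wt P i j \<le> C" for i j
  proof -
    have "wt P i j \<le> (\<Sum>j\<in>UNIV. wt P i j)" using w by (simp add: member_le_sum)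
    also have "\<dots> \<le> C"
      unfolding C_def using w by (intro member_le_sum[of i UNIV "\<lambda>i. \<Sum>j\<in>UNIV. wt P i j"]) (auto intro: sum_nonneg)
    finally show ?thesis .
  qed
  then interpret block_model P C using P by unfold_locales auto
  show ?thesis
  proof (rule exists_slow_rate)
    fix \<epsilon> :: real assume "0 < \<epsilon>"
    then show "(\<lambda>n. measure_pmf.prob (random_block_graph n (b n) P)
           {E. \<exists>\<eta>. \<bar>\<eta>\<bar> \<le> \<epsilon> \<and>
               real (chromatic_number {..<n} E) = (1 + \<eta>) * (real n / (cstar \<alpha> P * ln (real n)))}) \<longlonglongrightarrow> 1"
      by (rule chromatic_concentration[OF alpha blocks])
  next
    fix n and x y :: real assume "x \<le> y"
    then show "measure_pmf.prob (random_block_graph n (b n) P)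
           {E. \<exists>\<eta>. \<bar>\<eta>\<bar> \<le> x \<and>
               real (chromatic_number {..<n} E) = (1 + \<eta>) * (real n / (cstar \<alpha> P * ln (real n)))}
      \<le> measure_pmf.prob (random_block_graph n (b n) P)
           {E. \<exists>\<eta>. \<bar>\<eta>\<bar> \<le> y \<and>
               real (chromatic_number {..<n} E) = (1 + \<eta>) * (real n / (cstar \<alpha> P * ln (real n)))}"
      by (intro measure_pmf.finite_measure_mono) (auto intro: order_trans)
  qed auto
qed

end
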